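(* The LCL algorithm for the Maximum Matrix Contraction problem can be implemented to run in time $O(p\cdot q)$ on a $p\times q$ binary input matrix.
   Context: A binary matrix has entries in $\{0,1\}$. For a binary matrix, contracting line $i$ with line $i+1$ means replacing line $i$ by the sum of lines $i$ and $i+1$ and deleting line $i+1$ (shifting the lines below up); contracting column $j$ with column $j+1$ is defined analogously. A contraction (or sequence of contractions) is valid if the resulting matrix is still binary, i.e. no two $1$-entries are brought into the same entry. The density of a binary matrix is the number of unordered pairs of $1$-entries at positions $(i,j),(i',j')$ with $\max(|i-i'|,|j-j'|)=1$. The Maximum Matrix Contraction problem asks for a set of lines and columns of a given $p\times q$ binary matrix $M$ whose joint contraction is valid and maximizes the density of the result. The LCL algorithm: (LC part) starting from $M$, for each line $i$ from $p-1$ down to $1$, if contracting line $i$ with line $i+1$ in the current matrix is valid, perform it; then for each column $j$ from $q-1$ down to $1$, if contracting column $j$ with column $j+1$ in the current matrix is valid, perform it; call the result $M^{LC}$. (CL part) the same procedure processing columns first and then lines, giving $M^{CL}$. The algorithm returns whichever of $M^{LC}$, $M^{CL}$ (with the corresponding sets of contracted lines and columns) has the larger density. *)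

theory Defs
  imports "Jordan_Normal_Form.Matrix"
begin

section \<open>Contractions and the LCL algorithm\<close>

text \<open>
  Lines and columns are numbered from 0, so a matrix with \<open>p\<close> lines and \<open>q\<close> columns has the
  contractible lines \<open>0, \<dots>, p - 2\<close> and the contractible columns \<open>0, \<dots>, q - 2\<close>.
\<close>

definition binary_mat :: "nat mat \<Rightarrow> bool" where
  "binary_mat A \<longleftrightarrow> elements_mat A \<subseteq> {0, 1}"

definition contract_line :: "nat \<Rightarrow> nat mat \<Rightarrow> nat mat" where
  "contract_line i A = mat (dim_row A - 1) (dim_col A)
     (\<lambda>(r, c). if r < i then A $$ (r, c)
               else if r = i then A $$ (i, c) + A $$ (i + 1, c)
               else A $$ (r + 1, c))"

definition contract_col :: "nat \<Rightarrow> nat mat \<Rightarrow> nat mat" where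
  "contract_col j A = mat (dim_row A) (dim_col A - 1)
     (\<lambda>(r, c). if c < j then A $$ (r, c)
               else if c = j then A $$ (r, j) + A $$ (r, j + 1)
               else A $$ (r, c + 1))"

definition one_positions :: "nat mat \<Rightarrow> (nat \<times> nat) set" where
  "one_positions A = {(i, j). i < dim_row A \<and> j < dim_col A \<and> A $$ (i, j) = 1}"

definition density :: "nat mat \<Rightarrow> nat" where
  "density A = card {{(i, j), (i', j')} | i j i' j'.
     (i, j) \<in> one_positions A \<and> (i', j') \<in> one_positions A \<and>
     max \<bar>int i - int i'\<bar> \<bar>int j - int j'\<bar> = 1}"

text \<open>
  A pass runs through the indices in decreasing order, and contracting line \<open>i\<close> moves only lines
  below it. Hence, when line \<open>i\<close> is processed, its number in the current matrix is still its number
  in the matrix at the start of the pass, and the collected indices refer to the original numbering.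
\<close>

definition line_step :: "nat \<Rightarrow> nat mat \<times> nat set \<Rightarrow> nat mat \<times> nat set" where
  "line_step i = (\<lambda>(A, S). if binary_mat (contract_line i A)
     then (contract_line i A, insert i S) else (A, S))"

definition col_step :: "nat \<Rightarrow> nat mat \<times> nat set \<Rightarrow> nat mat \<times> nat set" where
  "col_step j = (\<lambda>(A, S). if binary_mat (contract_col j A)
     then (contract_col j A, insert j S) else (A, S))"

definition line_pass :: "nat mat \<Rightarrow> nat mat \<times> nat set" where
  "line_pass A = fold line_step (rev [0..<dim_row A - 1]) (A, {})"

definition col_pass :: "nat mat \<Rightarrow> nat mat \<times> nat set" where
  "col_pass A = fold col_step (rev [0..<dim_col A - 1]) (A, {})"

text \<open>Outcomes have the form (contracted matrix, contracted lines, contracted columns).\<close>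

type_synonym outcome = "nat mat \<times> nat set \<times> nat set"

definition LC_part :: "nat mat \<Rightarrow> outcome" where
  "LC_part M = (let (A, L) = line_pass M; (B, C) = col_pass A in (B, L, C))"

definition CL_part :: "nat mat \<Rightarrow> outcome" where
  "CL_part M = (let (A, C) = col_pass M; (B, L) = line_pass A in (B, L, C))"

text \<open>If both parts reach the same density, either of them may be returned.\<close>

definition LCL_returns :: "nat mat \<Rightarrow> outcome \<Rightarrow> bool" where
  "LCL_returns M R \<longleftrightarrow>
     R = LC_part M \<and> density (fst (LC_part M)) \<ge> density (fst (CL_part M)) \<or>
     R = CL_part M \<and> density (fst (CL_part M)) \<ge> density (fst (LC_part M))"

section \<open>Random access machine with a running time\<close>

text \<open>
  Programs act on registers, which they name literally, and on a memory, which they address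
  indirectly through registers. Both hold natural numbers. There is no multiplication.
\<close>

record ram =
  reg :: "nat \<Rightarrow> nat"
  mem :: "nat \<Rightarrow> nat"

datatype com =
    Skip
  | Const nat nat
  | Move nat nat
  | Add nat nat nat
  | Sub nat nat nat
  | Load nat nat
  | Store nat nat
  | Seq com com
  | IfLess nat nat com com
  | WhileLess nat nat com

definition set_reg :: "nat \<Rightarrow> nat \<Rightarrow> ram \<Rightarrow> ram" where
  "set_reg r v s = s\<lparr>reg := (reg s)(r := v)\<rparr>"

definition set_mem :: "nat \<Rightarrow> nat \<Rightarrow> ram \<Rightarrow> ram" where
  "set_mem a v s = s\<lparr>mem := (mem s)(a := v)\<rparr>"

text \<open>
  \<open>exec W c s t s'\<close>: started in \<open>s\<close>, program \<open>c\<close> halts in \<open>s'\<close> after exactly \<open>t\<close> steps on a machine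
  whose words hold the numbers up to \<open>W\<close>. Every instruction and every evaluation of a test costs
  one step. A computation that would produce a number exceeding \<open>W\<close> gets stuck, so that unit cost
  per instruction is not abused by computing with huge numbers. \<open>Sub\<close> is truncated at 0.
\<close>

inductive exec :: "nat \<Rightarrow> com \<Rightarrow> ram \<Rightarrow> nat \<Rightarrow> ram \<Rightarrow> bool" for W :: nat where
  Skip: "exec W Skip s 1 s"
| Const: "k \<le> W \<Longrightarrow> exec W (Const r k) s 1 (set_reg r k s)"
| Move: "exec W (Move r a) s 1 (set_reg r (reg s a) s)"
| Add: "reg s a + reg s b \<le> W \<Longrightarrow> exec W (Add r a b) s 1 (set_reg r (reg s a + reg s b) s)"
| Sub: "exec W (Sub r a b) s 1 (set_reg r (reg s a - reg s b) s)"
| Load: "exec W (Load r a) s 1 (set_reg r (mem s (reg s a)) s)"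
| Store: "exec W (Store a r) s 1 (set_mem (reg s a) (reg s r) s)"
| Seq: "exec W c1 s t1 s1 \<Longrightarrow> exec W c2 s1 t2 s2 \<Longrightarrow> exec W (Seq c1 c2) s (t1 + t2) s2"
| IfTrue: "reg s a < reg s b \<Longrightarrow> exec W c1 s t s1 \<Longrightarrow> exec W (IfLess a b c1 c2) s (1 + t) s1"
| IfFalse: "\<not> reg s a < reg s b \<Longrightarrow> exec W c2 s t s1 \<Longrightarrow> exec W (IfLess a b c1 c2) s (1 + t) s1"
| WhileFalse: "\<not> reg s a < reg s b \<Longrightarrow> exec W (WhileLess a b c) s 1 s"
| WhileTrue: "reg s a < reg s b \<Longrightarrow> exec W c s t1 s1 \<Longrightarrow> exec W (WhileLess a b c) s1 t2 s2 \<Longrightarrow>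
    exec W (WhileLess a b c) s (1 + t1 + t2) s2"

text \<open>Programs are deterministic, so \<open>t\<close> is the running time on the given input.\<close>

lemma exec_deterministic:
  "exec W c s t s' \<Longrightarrow> exec W c s u s'' \<Longrightarrow> u = t \<and> s'' = s'"
proof (induction arbitrary: u s'' rule: exec.induct)
  case (Seq c1 s t1 s1 c2 t2 s2)
  from Seq.prems show ?case
    by cases (use Seq.IH in blast)
next
  case (IfTrue s a b c1 t s1 c2)
  from IfTrue.prems show ?case
    by cases (use IfTrue.IH IfTrue.hyps in blast)+
next
  case (IfFalse s a b c2 t s1 c1)
  from IfFalse.prems show ?case
    by cases (use IfFalse.IH IfFalse.hyps in blast)+
next
  case (WhileFalse s a b c)
  from WhileFalse.prems show ?case
    by cases (use WhileFalse.hyps in simp_all)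
next
  case (WhileTrue s a b c t1 s1 t2 s2)
  from WhileTrue.prems show ?case
    by cases (use WhileTrue.IH WhileTrue.hyps in blast)+
qed (erule exec.cases; simp)+

text \<open>
  Input convention: the dimensions are in registers 0 and 1, the entries are stored row by row
  from address 0 on, and everything else is 0.
\<close>

definition input_state :: "nat mat \<Rightarrow> ram" where
  "input_state M = \<lparr>
     reg = (\<lambda>r. if r = 0 then dim_row M else if r = 1 then dim_col M else 0),
     mem = (\<lambda>a. if a < dim_row M * dim_col M
                then M $$ (a div dim_col M, a mod dim_col M) else 0)\<rparr>"

definition holds_matrix :: "ram \<Rightarrow> nat \<Rightarrow> nat mat \<Rightarrow> bool" where
  "holds_matrix s b A \<longleftrightarrow>
     (\<forall>i<dim_row A. \<forall>j<dim_col A. mem s (b + i * dim_col A + j) = A $$ (i, j))"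

definition holds_set :: "ram \<Rightarrow> nat \<Rightarrow> nat \<Rightarrow> nat set \<Rightarrow> bool" where
  "holds_set s b n S \<longleftrightarrow>
     S \<subseteq> {..<n} \<and> (\<forall>i<n. mem s (b + i) = (if i \<in> S then 1 else 0))"

text \<open>
  Output convention: registers 0 and 1 contain the dimensions of the contracted matrix, and registers
  2, 3 and 4 the addresses of its entries (row by row) and of the characteristic vectors of the sets
  of contracted lines and columns of the \<open>p \<times> q\<close> input matrix.
\<close>

definition outputs :: "nat \<Rightarrow> nat \<Rightarrow> ram \<Rightarrow> outcome \<Rightarrow> bool" where
  "outputs p q s = (\<lambda>(B, L, C).
     reg s 0 = dim_row B \<and> reg s 1 = dim_col B \<and>
     holds_matrix s (reg s 2) B \<and>
     holds_set s (reg s 3) (p - 1) L \<and>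
     holds_set s (reg s 4) (q - 1) C)"

end

theory Submission
  imports Defs
begin

text \<open>
  Lines are processed from the bottom, so a line pass can work in place: the finished lines are stacked
  at the bottom of the region of the matrix, and line \<open>i\<close> is either added to the top line of the stack
  or becomes the new top. Each line costs \<open>O(q)\<close>. A column pass is the same program run with the two
  strides exchanged, and the CL part is the LC part of the transposed matrix. The density is the sum of
  the numbers of pairs of ones at the four relative positions right, down, down right and down left.
\<close>

section \<open>Running programs\<close>

text \<open>Moving up all lower lines at every contraction would cost O(p * q) each time and O(p^2 *
  q) in a pass; with the stack, a step touches only a bounded number of lines. The counting loop
  serves two ends: over 0/1 entries, the number of columns in which two lines both carry a 1 is a
  sum of products, so it decides validity (it must be 0) as well as density.

  The machine model shapes the rest. It cannot multiply, so addresses are cursors advanced by a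
  stride, and p * q and the address of the last line come from repeated addition. Words are bounded
  by a multiple of p * q, so every specification must also bound its counters and its cursors, which
  end one stride beyond the last entry. A pass destroys its input, so each part works on its own
  copy. All storage ends by address 7 * p * q; the word size 10 * p * q leaves room for the
  overshoot. Since both dimensions are at least 1, additive constants and terms in one dimension are
  absorbed into multiples of the number of cells.\<close>

definition runs :: "nat \<Rightarrow> com \<Rightarrow> ram \<Rightarrow> (nat \<Rightarrow> ram \<Rightarrow> bool) \<Rightarrow> bool" where
  "runs W c s Q \<longleftrightarrow> (\<exists>t s'. exec W c s t s' \<and> Q t s')"

inductive_simps exec_iff:
  "exec W Skip s t s'"
  "exec W (Const r k) s t s'"
  "exec W (Move r a) s t s'"
  "exec W (Add r a b) s t s'"
  "exec W (Sub r a b) s t s'"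
  "exec W (Load r a) s t s'"
  "exec W (Store a r) s t s'"
  "exec W (Seq c1 c2) s t s'"
  "exec W (IfLess a b c1 c2) s t s'"

text \<open>Equivalences instead of introduction rules let the simplifier execute straight-line code
  symbolically. The elapsed time is an argument of the postcondition, so one goal carries both
  correctness and cost.\<close>

lemma runs_simps:
  "runs W Skip s Q \<longleftrightarrow> Q 1 s"
  "runs W (Const r k) s Q \<longleftrightarrow> k \<le> W \<and> Q 1 (set_reg r k s)"
  "runs W (Move r a) s Q \<longleftrightarrow> Q 1 (set_reg r (reg s a) s)"
  "runs W (Add r a b) s Q \<longleftrightarrow> reg s a + reg s b \<le> W \<and> Q 1 (set_reg r (reg s a + reg s b) s)"
  "runs W (Sub r a b) s Q \<longleftrightarrow> Q 1 (set_reg r (reg s a - reg s b) s)"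
  "runs W (Load r a) s Q \<longleftrightarrow> Q 1 (set_reg r (mem s (reg s a)) s)"
  "runs W (Store a r) s Q \<longleftrightarrow> Q 1 (set_mem (reg s a) (reg s r) s)"
  "runs W (IfLess a b c1 c2) s Q \<longleftrightarrow>
     (if reg s a < reg s b then runs W c1 s (\<lambda>t. Q (1 + t)) else runs W c2 s (\<lambda>t. Q (1 + t)))"
  unfolding runs_def by (auto simp: exec_iff)

lemma runs_Seq:
  "runs W (Seq c1 c2) s Q \<longleftrightarrow> runs W c1 s (\<lambda>t1 s1. runs W c2 s1 (\<lambda>t2. Q (t1 + t2)))"
  unfolding runs_def by (force simp: exec_iff)

lemma runs_weaken:
  "runs W c s Q \<Longrightarrow> (\<And>t s'. Q t s' \<Longrightarrow> Q' t s') \<Longrightarrow> runs W c s Q'"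
  unfolding runs_def by blast

lemma state_simps:
  "reg (set_reg r v s) = (reg s)(r := v)"
  "mem (set_reg r v s) = mem s"
  "reg (set_mem a v s) = reg s"
  "mem (set_mem a v s) = (mem s)(a := v)"
  by (simp_all add: set_reg_def set_mem_def)

lemmas step_simps = runs_simps runs_Seq state_simps

section \<open>Frame property: registers that a program cannot write\<close>

fun writes :: "com \<Rightarrow> nat set" where
  "writes Skip = {}"
| "writes (Const r k) = {r}"
| "writes (Move r a) = {r}"
| "writes (Add r a b) = {r}"
| "writes (Sub r a b) = {r}"
| "writes (Load r a) = {r}"
| "writes (Store a r) = {}"
| "writes (Seq c1 c2) = writes c1 \<union> writes c2"
| "writes (IfLess a b c1 c2) = writes c1 \<union> writes c2"
| "writes (WhileLess a b c) = writes c"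

text \<open>Only registers are compared. The memory cells that a program changes depend on computed
  addresses, so memory frames are stated in each specification.\<close>

definition agree :: "nat set \<Rightarrow> ram \<Rightarrow> ram \<Rightarrow> bool" where
  "agree X s s' \<longleftrightarrow> (\<forall>r. r \<notin> X \<longrightarrow> reg s' r = reg s r)"

lemma agree_reg: "agree X s s' \<Longrightarrow> r \<notin> X \<Longrightarrow> reg s' r = reg s r"
  by (simp add: agree_def)

lemma agree_refl: "agree X s s"
  by (simp add: agree_def)

lemma agree_trans: "agree X s s' \<Longrightarrow> agree X s' s'' \<Longrightarrow> agree X s s''"
  by (simp add: agree_def)

lemma agree_mono: "agree X s s' \<Longrightarrow> X \<subseteq> Y \<Longrightarrow> agree Y s s'"
  by (auto simp: agree_def)

lemma agree_step: "agree Y s' s'' \<Longrightarrow> Y \<subseteq> X \<Longrightarrow> agree X s s' \<Longrightarrow> agree X s s''"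
  by (auto simp: agree_def)

lemma exec_agree: "exec W c s t s' \<Longrightarrow> agree (writes c) s s'"
  by (induction rule: exec.induct) (auto simp: agree_def state_simps)

lemma runs_agree:
  "runs W c s Q \<Longrightarrow> runs W c s (\<lambda>t s'. Q t s' \<and> agree (writes c) s s')"
  unfolding runs_def using exec_agree by blast

text \<open>One test and at most \<open>T\<close> steps per iteration, plus the failing last test,
  give the bound. The frame fact is handed to the premises, so that \<open>I\<close> need only
  describe what changes; registers fixed by the body are read off from the start state.\<close>

lemma runs_for:
  assumes "I 0 s"
    and step: "\<And>k s'. k < n \<Longrightarrow> I k s' \<Longrightarrow> agree (writes c) s s' \<Longrightarrow>
      reg s' a < reg s' b \<and> runs W c s' (\<lambda>t s''. t \<le> T \<and> I (Suc k) s'')"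
    and stop: "\<And>s'. I n s' \<Longrightarrow> agree (writes c) s s' \<Longrightarrow> \<not> reg s' a < reg s' b"
  shows "runs W (WhileLess a b c) s (\<lambda>t s'. t \<le> n * (T + 1) + 1 \<and> I n s' \<and> agree (writes c) s s')"
proof -
  \<comment> \<open>Generalised to a loop entered after \<open>k\<close> iterations, for induction
    on the number of iterations that remain.\<close>
  have "I k s' \<Longrightarrow> agree (writes c) s s' \<Longrightarrow> k \<le> n \<Longrightarrow>
    runs W (WhileLess a b c) s' (\<lambda>t s''. t \<le> (n - k) * (T + 1) + 1 \<and> I n s'' \<and> agree (writes c) s s'')" for k s'
  proof (induction "n - k" arbitrary: k s')
    case 0
    then show ?case
      using stop[of s'] unfolding runs_def by (force intro: exec.WhileFalse)
  next
    case (Suc d)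
    then have k: "k < n" and d: "n - k = Suc d" "n - Suc k = d" by auto
    note st = step[OF k Suc.prems(1,2)]
    then have lt: "reg s' a < reg s' b" ..
    from runs_agree[OF st[THEN conjunct2]] obtain t1 s1 where 1: "exec W c s' t1 s1" "t1 \<le> T" "I (Suc k) s1" "agree (writes c) s' s1"
      unfolding runs_def by auto
    from Suc.hyps(1)[of "Suc k" s1] k d 1 agree_trans[OF Suc.prems(2) 1(4)]
    obtain t2 s2 where 2: "exec W (WhileLess a b c) s1 t2 s2" "t2 \<le> d * (T + 1) + 1"
        "I n s2" "agree (writes c) s s2"
      unfolding runs_def by auto
    from exec.WhileTrue[of s' a b, OF lt 1(1) 2(1)] 1 2 d show ?case
      unfolding runs_def by (auto intro!: exI)
  qed
  from this[of 0 s] assms(1) show ?thesis by (simp add: agree_refl)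
qed

section \<open>Loops over the entries of a strided matrix\<close>

notation Seq (infixr ";;" 60)

text \<open>
  Registers. A matrix of \<open>rM\<close> lines and \<open>rN\<close> columns is traversed with the distances \<open>rRS\<close> between
  consecutive lines and \<open>rCS\<close> between consecutive columns, so that exchanging the two distances
  (and the dimensions) transposes it.
\<close>

abbreviation (input) rOne :: nat where "rOne \<equiv> 5"
abbreviation (input) rSize :: nat where "rSize \<equiv> 6"
abbreviation (input) rZero :: nat where "rZero \<equiv> 7"
abbreviation (input) rBase :: nat where "rBase \<equiv> 10"
abbreviation (input) rRS :: nat where "rRS \<equiv> 11"
abbreviation (input) rCS :: nat where "rCS \<equiv> 12"
abbreviation (input) rM :: nat where "rM \<equiv> 13"
abbreviation (input) rN :: nat where "rN \<equiv> 14"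
abbreviation (input) rSet :: nat where "rSet \<equiv> 15"
abbreviation (input) rI :: nat where "rI \<equiv> 16"
abbreviation (input) rK :: nat where "rK \<equiv> 17"
abbreviation (input) rA :: nat where "rA \<equiv> 18"
abbreviation (input) rB :: nat where "rB \<equiv> 19"
abbreviation (input) rX :: nat where "rX \<equiv> 20"
abbreviation (input) rY :: nat where "rY \<equiv> 21"
abbreviation (input) rJ :: nat where "rJ \<equiv> 22"
abbreviation (input) rU :: nat where "rU \<equiv> 23"
abbreviation (input) rV :: nat where "rV \<equiv> 24"
abbreviation (input) rCount :: nat where "rCount \<equiv> 26"
abbreviation (input) rRS2 :: nat where "rRS2 \<equiv> 28"

definition row_loop :: "com \<Rightarrow> com" where
  "row_loop body = Move rX rA ;; Move rY rB ;; Const rJ 0 ;;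
     WhileLess rJ rN (body ;; Add rX rX rCS ;; Add rY rY rCS ;; Add rJ rJ rOne)"

definition grid_loop :: "com \<Rightarrow> com" where
  "grid_loop body = Const rI 0 ;;
     WhileLess rI rM (row_loop body ;; Add rA rA rRS ;; Add rB rB rRS2 ;; Add rI rI rOne)"

text \<open>As \<open>body\<close> writes only two scratch registers and the counter, the invariant
  \<open>J\<close> sees just the counter and the memory. An entry costs 6 for the body, 3 additions
  and a test. The bounds reach \<open>n * cs\<close> because the cursors are advanced even after the
  last entry.\<close>

lemma row_loop:
  assumes regs: "reg s rOne = 1" "reg s rA = a" "reg s rB = b" "reg s rCS = cs" "reg s rN = n"
    and bounds: "a + n * cs \<le> W" "b + n * cs \<le> W" "n \<le> W"
    and body: "writes body \<subseteq> {rU, rV, rCount}"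
    and init: "J 0 (reg s rCount) (mem s)"
    and step: "\<And>k s'. k < n \<Longrightarrow> J k (reg s' rCount) (mem s') \<Longrightarrow> reg s' rOne = 1 \<Longrightarrow>
      reg s' rX = a + k * cs \<Longrightarrow> reg s' rY = b + k * cs \<Longrightarrow>
      runs W body s' (\<lambda>t s''. t \<le> 6 \<and> J (Suc k) (reg s'' rCount) (mem s''))"
  shows "runs W (row_loop body) s (\<lambda>t s'. t \<le> 10 * n + 4 \<and> J n (reg s' rCount) (mem s') \<and>
    agree {rX, rY, rJ, rU, rV, rCount} s s')"
proof -
  let ?c = "body ;; Add rX rX rCS ;; Add rY rY rCS ;; Add rJ rJ rOne"
  let ?X = "{rX, rY, rJ, rU, rV, rCount}"
  let ?I = "\<lambda>(k::nat) (s'::ram). J k (reg s' rCount) (mem s') \<and> reg s' rX = a + k * cs \<and> reg s' rY = b + k * cs \<and>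
    reg s' rJ = k"
  let ?s = "set_reg rJ 0 (set_reg rY b (set_reg rX a s))"
  have X: "writes ?c \<subseteq> ?X"
    using body by auto
  have loop: "runs W (WhileLess rJ rN ?c) ?s
     (\<lambda>t s'. t \<le> n * (9 + 1) + 1 \<and> ?I n s' \<and> agree (writes ?c) ?s s')"
  proof (rule runs_for)
    show "?I 0 ?s" using init by (simp add: state_simps)
  next
    fix k :: nat and s' :: ram assume k: "k < n" and I: "?I k s'" and w: "agree (writes ?c) ?s s'"
    have ag: "agree ?X ?s s'" using w X by (rule agree_mono)
    have eqs: "reg s' rOne = 1" "reg s' rCS = cs" "reg s' rN = n"
      using regs by (simp_all add: agree_reg[OF ag] state_simps)
    from k have "Suc k * cs \<le> n * cs" by (intro mult_le_mono1) simp
    then have b': "a + k * cs + cs \<le> W" "b + k * cs + cs \<le> W" "k + 1 \<le> W" using bounds k by auto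
    have "runs W body s' (\<lambda>t s''. (t \<le> 6 \<and> J (Suc k) (reg s'' rCount) (mem s'')) \<and>
      agree (writes body) s' s'')"
      using step[OF k] I eqs by (intro runs_agree) simp
    then have "runs W ?c s' (\<lambda>t s''. t \<le> 9 \<and> ?I (Suc k) s'')"
      unfolding runs_Seq
    proof (rule runs_weaken, elim conjE)
      fix t :: nat and s'' :: ram assume "agree (writes body) s' s''"
      then have ag': "agree {rU, rV, rCount} s' s''" using body by (rule agree_mono)
      assume "t \<le> 6" "J (Suc k) (reg s'' rCount) (mem s'')"
      then show "runs W (Add rX rX rCS) s'' (\<lambda>t1 s1. runs W (Add rY rY rCS) s1
          (\<lambda>t2 s2. runs W (Add rJ rJ rOne) s2 (\<lambda>t2' s''. t + (t1 + (t2 + t2')) \<le> 9 \<and> ?I (Suc k) s'')))"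
        using eqs I b' by (simp add: step_simps agree_reg[OF ag'] algebra_simps)
    qed
    then show "reg s' rJ < reg s' rN \<and> runs W ?c s' (\<lambda>t s''. t \<le> 9 \<and> ?I (Suc k) s'')"
      using k I eqs by simp
  next
    fix s' :: ram assume I: "?I n s'" and w: "agree (writes ?c) ?s s'"
    have ag: "agree ?X ?s s'" using w X by (rule agree_mono)
    show "\<not> reg s' rJ < reg s' rN" using I regs by (simp add: agree_reg[OF ag] state_simps)
  qed
  have sX: "agree ?X s ?s" by (simp add: agree_def state_simps)
  have "runs W (WhileLess rJ rN ?c) ?s (\<lambda>t s'. 1 + (1 + (1 + t)) \<le> 10 * n + 4 \<and>
      J n (reg s' rCount) (mem s') \<and> agree ?X s s')"
    using loop by (rule runs_weaken) (use agree_step[OF _ X sX] in \<open>simp add: algebra_simps\<close>)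
  then show ?thesis
    by (simp only: row_loop_def runs_Seq runs_simps regs state_simps fun_upd_apply) simp
qed

text \<open>Source and target have separate row strides, so that the same loop can compact a matrix
  while copying it.\<close>

lemma grid_loop:
  assumes regs: "reg s rOne = 1" "reg s rA = a" "reg s rB = b" "reg s rM = m"
      "reg s rRS = rs" "reg s rRS2 = rs2"
    and bounds: "a + m * rs \<le> W" "b + m * rs2 \<le> W" "m \<le> W"
    and body: "writes body \<subseteq> {rU, rV, rCount}"
    and init: "J 0 (reg s rCount) (mem s)"
    and step: "\<And>k s'. k < m \<Longrightarrow> J k (reg s' rCount) (mem s') \<Longrightarrow>
      agree {rI, rA, rB, rX, rY, rJ, rU, rV, rCount} s s' \<Longrightarrow>
      reg s' rA = a + k * rs \<Longrightarrow> reg s' rB = b + k * rs2 \<Longrightarrow>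
      runs W (row_loop body) s' (\<lambda>t s''. t \<le> T \<and> J (Suc k) (reg s'' rCount) (mem s''))"
  shows "runs W (grid_loop body) s (\<lambda>t s'. t \<le> m * (T + 4) + 2 \<and> J m (reg s' rCount) (mem s') \<and>
    agree {rI, rA, rB, rX, rY, rJ, rU, rV, rCount} s s')"
proof -
  let ?c = "row_loop body ;; Add rA rA rRS ;; Add rB rB rRS2 ;; Add rI rI rOne"
  let ?X = "{rI, rA, rB, rX, rY, rJ, rU, rV, rCount}"
  let ?Y = "{rX, rY, rJ, rU, rV, rCount}"
  let ?I = "\<lambda>(k::nat) (s'::ram). J k (reg s' rCount) (mem s') \<and> reg s' rA = a + k * rs \<and> reg s' rB = b + k * rs2 \<and>
    reg s' rI = k"
  let ?s = "set_reg rI 0 s"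
  have Y: "writes (row_loop body) \<subseteq> ?Y"
    using body by (auto simp: row_loop_def)
  then have X: "writes ?c \<subseteq> ?X" by auto
  have sX: "agree ?X s ?s" by (simp add: agree_def state_simps)
  have loop: "runs W (WhileLess rI rM ?c) ?s
     (\<lambda>t s'. t \<le> m * (T + 3 + 1) + 1 \<and> ?I m s' \<and> agree (writes ?c) ?s s')"
  proof (rule runs_for)
    show "?I 0 ?s" using init regs by (simp add: state_simps)
  next
    fix k :: nat and s' :: ram assume k: "k < m" and I: "?I k s'" and w: "agree (writes ?c) ?s s'"
    have ag: "agree ?X s s'" using w X sX by (rule agree_step)
    have eqs: "reg s' rOne = 1" "reg s' rM = m" "reg s' rRS = rs" "reg s' rRS2 = rs2"
      using regs by (simp_all add: agree_reg[OF ag] state_simps)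
    from k have "Suc k * rs \<le> m * rs" "Suc k * rs2 \<le> m * rs2" by (intro mult_le_mono1; simp)+
    then have b': "a + k * rs + rs \<le> W" "b + k * rs2 + rs2 \<le> W" "k + 1 \<le> W" using bounds k by auto
    have "runs W (row_loop body) s' (\<lambda>t s''. (t \<le> T \<and> J (Suc k) (reg s'' rCount) (mem s'')) \<and>
      agree (writes (row_loop body)) s' s'')"
      using step[OF k _ ag] I eqs by (intro runs_agree) simp
    then have "runs W ?c s' (\<lambda>t s''. t \<le> T + 3 \<and> ?I (Suc k) s'')"
      unfolding runs_Seq
    proof (rule runs_weaken, elim conjE)
      fix t :: nat and s'' :: ram assume "agree (writes (row_loop body)) s' s''"
      then have ag': "agree ?Y s' s''" using Y by (rule agree_mono)
      assume "t \<le> T" "J (Suc k) (reg s'' rCount) (mem s'')"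
      then show "runs W (Add rA rA rRS) s'' (\<lambda>t1 s1. runs W (Add rB rB rRS2) s1
          (\<lambda>t2 s2. runs W (Add rI rI rOne) s2 (\<lambda>t2' s''. t + (t1 + (t2 + t2')) \<le> T + 3 \<and> ?I (Suc k) s'')))"
        using eqs I b' by (simp add: step_simps agree_reg[OF ag'] algebra_simps)
    qed
    then show "reg s' rI < reg s' rM \<and> runs W ?c s' (\<lambda>t s''. t \<le> T + 3 \<and> ?I (Suc k) s'')"
      using k I eqs by simp
  next
    fix s' :: ram assume I: "?I m s'" and w: "agree (writes ?c) ?s s'"
    have ag: "agree ?X ?s s'" using w X by (rule agree_mono)
    show "\<not> reg s' rI < reg s' rM" using I regs by (simp add: agree_reg[OF ag] state_simps)
  qed
  have "runs W (WhileLess rI rM ?c) ?s (\<lambda>t s'. 1 + t \<le> m * (T + 4) + 2 \<and>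
      J m (reg s' rCount) (mem s') \<and> agree ?X s s')"
    using loop by (rule runs_weaken) (use agree_step[OF _ X sX] in \<open>simp add: algebra_simps\<close>)
  then show ?thesis
    by (simp add: grid_loop_def runs_Seq runs_simps)
qed

section \<open>Loop bodies for counting, copying and adding\<close>

text \<open>Two bits have a sum above 1 exactly when their product is 1; this test stands in for
  multiplication.\<close>

definition count_body :: com where
  "count_body = Load rU rX ;; Load rV rY ;; Add rU rU rV ;;
     IfLess rOne rU (Add rCount rCount rOne) Skip"

definition copy_body :: com where
  "copy_body = Load rU rX ;; Store rY rU"

definition add_body :: com where
  "add_body = Load rU rX ;; Load rV rY ;; Add rU rU rV ;; Store rY rU"

text \<open>Used for the validity test, with the two lines to be merged, and for the density, with
  two shifted views of one matrix. Words must hold 2, the largest sum of two bits.\<close>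

lemma row_count:
  assumes regs: "reg s rOne = 1" "reg s rA = a" "reg s rB = b" "reg s rCS = cs" "reg s rN = n"
    and bounds: "a + n * cs \<le> W" "b + n * cs \<le> W" "reg s rCount + n \<le> W" "2 \<le> W"
    and bin: "\<And>j. j < n \<Longrightarrow> mem s (a + j * cs) \<le> 1" "\<And>j. j < n \<Longrightarrow> mem s (b + j * cs) \<le> 1"
  shows "runs W (row_loop count_body) s (\<lambda>t s'. t \<le> 10 * n + 4 \<and> mem s' = mem s \<and>
    reg s' rCount = reg s rCount + (\<Sum>j<n. mem s (a + j * cs) * mem s (b + j * cs)) \<and>
    agree {rX, rY, rJ, rU, rV, rCount} s s')"
proof -
  let ?f = "\<lambda>j. mem s (a + j * cs) * mem s (b + j * cs)"
  let ?J = "\<lambda>k x \<mu>. x = reg s rCount + sum ?f {..<k} \<and> \<mu> = mem s"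
  have "runs W (row_loop count_body) s (\<lambda>t s'. t \<le> 10 * n + 4 \<and> ?J n (reg s' rCount) (mem s') \<and>
    agree {rX, rY, rJ, rU, rV, rCount} s s')"
  proof (rule row_loop[OF regs bounds(1,2)])
    fix k :: nat and s' :: ram assume k: "k < n" and J: "?J k (reg s' rCount) (mem s')" and 1: "reg s' rOne = 1"
      and xy: "reg s' rX = a + k * cs" "reg s' rY = b + k * cs"
    have le: "?f j \<le> 1" if "j < n" for j
      using bin[OF that] mult_le_mono[of _ 1 _ 1] by simp
    \<comment> \<open>The counter has gained at most \<open>k < n\<close> so far, so incrementing it
      stays within the word size.\<close>
    have "sum ?f {..<k} \<le> of_nat (card {..<k}) * 1" using k le by (intro sum_bounded_above) auto
    then have W: "reg s' rCount + 1 \<le> W" using J k bounds by simp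
    have u: "mem s (a + k * cs) \<in> {0, 1}" "mem s (b + k * cs) \<in> {0, 1}" using bin[OF k] by auto
    show "runs W count_body s' (\<lambda>t s''. t \<le> 6 \<and> ?J (Suc k) (reg s'' rCount) (mem s''))"
      using u 1 xy J W bounds(4) by (auto simp: count_body_def step_simps)
  qed (use bounds in \<open>auto simp: count_body_def\<close>)
  then show ?thesis by (rule runs_weaken) auto
qed

text \<open>\<open>apart\<close> admits the overlap \<open>a = b\<close>: as long as no contraction
  has succeeded, a pass copies each line onto itself. Apart from that no source cell is a target
  cell.\<close>

lemma row_copy:
  assumes regs: "reg s rOne = 1" "reg s rA = a" "reg s rB = b" "reg s rCS = cs" "reg s rN = n"
    and bounds: "a + n * cs \<le> W" "b + n * cs \<le> W" "n \<le> W"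
    and apart: "\<And>j k. j < n \<Longrightarrow> k < n \<Longrightarrow> a + k * cs = b + j * cs \<Longrightarrow> k = j" and cs: "0 < cs"
  shows "runs W (row_loop copy_body) s (\<lambda>t s'. t \<le> 10 * n + 4 \<and> reg s' rCount = reg s rCount \<and>
    (\<forall>j<n. mem s' (b + j * cs) = mem s (a + j * cs)) \<and>
    (\<forall>x. (\<forall>j<n. x \<noteq> b + j * cs) \<longrightarrow> mem s' x = mem s x) \<and>
    agree {rX, rY, rJ, rU, rV, rCount} s s')"
proof -
  let ?J = "\<lambda>k y \<mu>. y = reg s rCount \<and> (\<forall>j<k. \<mu> (b + j * cs) = mem s (a + j * cs)) \<and>
    (\<forall>x. (\<forall>j<k. x \<noteq> b + j * cs) \<longrightarrow> \<mu> x = mem s x)"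
  have "runs W (row_loop copy_body) s (\<lambda>t s'. t \<le> 10 * n + 4 \<and> ?J n (reg s' rCount) (mem s') \<and>
    agree {rX, rY, rJ, rU, rV, rCount} s s')"
  proof (rule row_loop[OF regs bounds])
    fix k :: nat and s' :: ram assume k: "k < n" and J: "?J k (reg s' rCount) (mem s')"
      and xy: "reg s' rX = a + k * cs" "reg s' rY = b + k * cs"
    have ne: "a + k * cs \<noteq> b + j * cs" if "j < k" for j using apart[of j k] k that by auto
    then have a: "mem s' (a + k * cs) = mem s (a + k * cs)" using J by blast
    show "runs W copy_body s' (\<lambda>t s''. t \<le> 6 \<and> ?J (Suc k) (reg s'' rCount) (mem s''))"
      using J xy a cs by (auto simp: copy_body_def step_simps less_Suc_eq)
  qed (auto simp: copy_body_def)
  then show ?thesis by (rule runs_weaken) auto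
qed

lemma row_add:
  assumes regs: "reg s rOne = 1" "reg s rA = a" "reg s rB = b" "reg s rCS = cs" "reg s rN = n"
    and bounds: "a + n * cs \<le> W" "b + n * cs \<le> W" "n \<le> W"
    and apart: "\<And>j k. j < n \<Longrightarrow> k < n \<Longrightarrow> a + k * cs \<noteq> b + j * cs" and cs: "0 < cs"
    and small: "\<And>j. j < n \<Longrightarrow> mem s (a + j * cs) + mem s (b + j * cs) \<le> W"
  shows "runs W (row_loop add_body) s (\<lambda>t s'. t \<le> 10 * n + 4 \<and> reg s' rCount = reg s rCount \<and>
    (\<forall>j<n. mem s' (b + j * cs) = mem s (a + j * cs) + mem s (b + j * cs)) \<and>
    (\<forall>x. (\<forall>j<n. x \<noteq> b + j * cs) \<longrightarrow> mem s' x = mem s x) \<and>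
    agree {rX, rY, rJ, rU, rV, rCount} s s')"
proof -
  let ?J = "\<lambda>k y \<mu>. y = reg s rCount \<and>
    (\<forall>j<k. \<mu> (b + j * cs) = mem s (a + j * cs) + mem s (b + j * cs)) \<and>
    (\<forall>x. (\<forall>j<k. x \<noteq> b + j * cs) \<longrightarrow> \<mu> x = mem s x)"
  have "runs W (row_loop add_body) s (\<lambda>t s'. t \<le> 10 * n + 4 \<and> ?J n (reg s' rCount) (mem s') \<and>
    agree {rX, rY, rJ, rU, rV, rCount} s s')"
  proof (rule row_loop[OF regs bounds])
    fix k :: nat and s' :: ram assume k: "k < n" and J: "?J k (reg s' rCount) (mem s')"
      and xy: "reg s' rX = a + k * cs" "reg s' rY = b + k * cs"
    have ne: "a + k * cs \<noteq> b + j * cs" if "j < k" for j using apart[of j k] k that by auto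
    then have a: "mem s' (a + k * cs) = mem s (a + k * cs)" using J by blast
    have ne': "b + k * cs \<noteq> b + j * cs" if "j < k" for j using cs that by auto
    then have b: "mem s' (b + k * cs) = mem s (b + k * cs)" using J by blast
    show "runs W add_body s' (\<lambda>t s''. t \<le> 6 \<and> ?J (Suc k) (reg s'' rCount) (mem s''))"
      using J xy a b cs small[OF k] by (auto simp: add_body_def step_simps less_Suc_eq)
  qed (auto simp: add_body_def)
  then show ?thesis by (rule runs_weaken) auto
qed

section \<open>A pass in place\<close>

lemma binary_mat_iff:
  "binary_mat A \<longleftrightarrow> (\<forall>i<dim_row A. \<forall>j<dim_col A. A $$ (i, j) \<le> 1)"
proof -
  have "elements_mat A \<subseteq> {0, 1} \<longleftrightarrow> (\<forall>i<dim_row A. \<forall>j<dim_col A. A $$ (i, j) \<in> {0, 1})"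
    unfolding elements_mat_def by fastforce
  then show ?thesis by (simp add: binary_mat_def le_Suc_eq)
qed

text \<open>Outside the merged line the entries are those of \<open>C\<close>. Within it, two bits
  add up to at most 1 iff their product is 0, and a sum of naturals vanishes iff all its terms
  do.\<close>

lemma binary_contract_line:
  assumes "binary_mat C" "Suc i < dim_row C"
  shows "binary_mat (contract_line i C) \<longleftrightarrow> (\<Sum>j<dim_col C. C $$ (i, j) * C $$ (Suc i, j)) = 0"
proof
  assume bin: "binary_mat (contract_line i C)"
  have "C $$ (i, j) * C $$ (Suc i, j) = 0" if "j < dim_col C" for j
  proof -
    have "i < dim_row (contract_line i C)" "j < dim_col (contract_line i C)"
      using that assms(2) by (simp_all add: contract_line_def)
    then have "contract_line i C $$ (i, j) \<le> 1"
      using bin unfolding binary_mat_iff by blast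
    then have "C $$ (i, j) + C $$ (Suc i, j) \<le> 1" using that assms(2) by (simp add: contract_line_def)
    then show ?thesis by auto
  qed
  then show "(\<Sum>j<dim_col C. C $$ (i, j) * C $$ (Suc i, j)) = 0" by simp
next
  assume "(\<Sum>j<dim_col C. C $$ (i, j) * C $$ (Suc i, j)) = 0"
  then have 0: "C $$ (i, j) = 0 \<or> C $$ (Suc i, j) = 0" if "j < dim_col C" for j using that by simp
  have 1: "C $$ (r, j) \<le> 1" if "r < dim_row C" "j < dim_col C" for r j
    using assms(1) that by (simp add: binary_mat_iff)
  show "binary_mat (contract_line i C)"
    unfolding binary_mat_iff
  proof (intro allI impI)
    fix r j assume "r < dim_row (contract_line i C)" "j < dim_col (contract_line i C)"
    then have r: "r < dim_row C - 1" and j: "j < dim_col C" by (simp_all add: contract_line_def)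
    have "C $$ (i, j) + C $$ (Suc i, j) \<le> 1"
      using 0[OF j] 1[of i j] 1[of "Suc i" j] j assms(2) by auto
    then show "contract_line i C $$ (r, j) \<le> 1"
      using r j 1 by (simp add: contract_line_def)
  qed
qed

text \<open>The pass cut off after its first \<open>k\<close> candidates, counted from the bottom;
  the loop invariant needs every such intermediate state. The candidate processed next is
  \<open>dim_row A - 2 - k\<close>.\<close>

definition line_steps :: "nat mat \<Rightarrow> nat \<Rightarrow> nat mat \<times> nat set" where
  "line_steps A k = fold line_step (rev [dim_row A - 1 - k..<dim_row A - 1]) (A, {})"

lemma line_steps_0: "line_steps A 0 = (A, {})"
  by (simp add: line_steps_def)

lemma line_steps_Suc:
  assumes "dim_row A - 1 - k = Suc i"
  shows "line_steps A (Suc k) = line_step i (line_steps A k)"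
proof -
  have "dim_row A - 1 - Suc k = i" "i < dim_row A - 1" using assms by auto
  then show ?thesis using assms by (simp add: line_steps_def upt_conv_Cons)
qed

lemma line_pass_steps: "line_pass A = line_steps A (dim_row A - 1)"
  by (simp add: line_pass_def line_steps_def)

text \<open>
  The state of a pass that has processed the lines from \<open>i\<close> on: the lines above \<open>i\<close> are still in
  their original place, the other lines of the current matrix \<open>C\<close> are stacked at the bottom of
  the region, from its line \<open>d\<close> on.
\<close>

definition stacked :: "(nat \<Rightarrow> nat \<Rightarrow> nat) \<Rightarrow> nat \<Rightarrow> nat \<Rightarrow> nat \<Rightarrow> nat \<Rightarrow> (nat \<Rightarrow> nat) \<Rightarrow> nat mat \<Rightarrow> bool" where
  "stacked adr m n i d \<mu> C \<longleftrightarrow> i \<le> d \<and> d < m \<and> dim_row C = i + (m - d) \<and> dim_col C = n \<and>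
     (\<forall>r<i. \<forall>c<n. \<mu> (adr r c) = C $$ (r, c)) \<and>
     (\<forall>r<m - d. \<forall>c<n. \<mu> (adr (d + r) c) = C $$ (i + r, c))"

text \<open>Contraction lowers the numbers of all lines in the stack by one, although nothing in
  memory moves. The renumbering is absorbed by the offset of the stack in \<open>C\<close>, which
  drops from \<open>Suc i\<close> to \<open>i\<close>.\<close>

lemma stacked_merge:
  assumes st: "stacked adr m n (Suc i) d \<mu> C"
    and new: "\<forall>c<n. \<mu>' (adr d c) = \<mu> (adr i c) + \<mu> (adr d c)"
    and old: "\<And>r c. r < m \<Longrightarrow> r \<noteq> d \<Longrightarrow> c < n \<Longrightarrow> \<mu>' (adr r c) = \<mu> (adr r c)"
  shows "stacked adr m n i d \<mu>' (contract_line i C)"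
proof -
  have up: "\<mu> (adr r c) = C $$ (r, c)" if "r < Suc i" "c < n" for r c
    using st that unfolding stacked_def by blast
  have low: "\<mu> (adr (d + r) c) = C $$ (Suc i + r, c)" if "r < m - d" "c < n" for r c
    using st that unfolding stacked_def by blast
  have d: "i < d" "d < m" "dim_row C = Suc i + (m - d)" "dim_col C = n"
    using st unfolding stacked_def by auto
  have "\<mu>' (adr (d + r) c) = contract_line i C $$ (i + r, c)" if "r < m - d" "c < n" for r c
  proof (cases "r = 0")
    case True
    then show ?thesis using that new up[of i c] low[of 0 c] d by (simp add: contract_line_def)
  next
    case False
    then show ?thesis using that old[of "d + r" c] low[of r c] d by (simp add: contract_line_def)
  qed
  then show ?thesis
    using d up old unfolding stacked_def by (auto simp: contract_line_def)
qed

text \<open>Here no line is renumbered: line \<open>i\<close> of \<open>C\<close> merely turns from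
  unprocessed into top of the stack. Its new slot \<open>d\<close> overwrites none of the lines
  still to be processed, as \<open>i <= d\<close>.\<close>

lemma stacked_push:
  assumes st: "stacked adr m n (Suc i) (Suc d) \<mu> C"
    and new: "\<forall>c<n. \<mu>' (adr d c) = \<mu> (adr i c)"
    and old: "\<And>r c. r < m \<Longrightarrow> r \<noteq> d \<Longrightarrow> c < n \<Longrightarrow> \<mu>' (adr r c) = \<mu> (adr r c)"
  shows "stacked adr m n i d \<mu>' C"
proof -
  have up: "\<mu> (adr r c) = C $$ (r, c)" if "r < Suc i" "c < n" for r c
    using st that unfolding stacked_def by blast
  have low: "\<mu> (adr (Suc d + r) c) = C $$ (Suc i + r, c)" if "r < m - Suc d" "c < n" for r c
    using st that unfolding stacked_def by blast
  have d: "i \<le> d" "Suc d < m" "dim_row C = Suc i + (m - Suc d)" "dim_col C = n"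
    using st unfolding stacked_def by auto
  have "\<mu>' (adr (d + r) c) = C $$ (i + r, c)" if "r < m - d" "c < n" for r c
  proof (cases r)
    case 0
    then show ?thesis using that new up[of i c] d by simp
  next
    case (Suc r')
    then show ?thesis using that old[of "d + r" c] low[of r' c] d by simp
  qed
  then show ?thesis
    using d up old unfolding stacked_def by auto
qed

lemma stacked_cong:
  assumes "stacked adr m n i d \<mu> C" "\<And>r c. r < m \<Longrightarrow> c < n \<Longrightarrow> \<mu>' (adr r c) = \<mu> (adr r c)"
  shows "stacked adr m n i d \<mu>' C"
  using assms unfolding stacked_def by auto

definition laid_out :: "(nat \<Rightarrow> nat) \<Rightarrow> nat \<Rightarrow> nat \<Rightarrow> nat \<Rightarrow> nat mat \<Rightarrow> bool" where
  "laid_out \<mu> b rs cs A \<longleftrightarrow> (\<forall>i<dim_row A. \<forall>j<dim_col A. \<mu> (b + i * rs + j * cs) = A $$ (i, j))"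

section \<open>The line pass as a program\<close>

text \<open>A positive count means a collision: the line is pushed, and \<open>rK\<close>, the
  height of the stack, grows. Otherwise the line is merged into the top and its index is marked in
  the characteristic vector at \<open>rSet\<close>.\<close>

definition pass_step :: com where
  "pass_step = Sub rI rI rOne ;; Sub rA rA rRS ;; Const rCount 0 ;; row_loop count_body ;;
     IfLess rZero rCount
       (Sub rB rB rRS ;; row_loop copy_body ;; Add rK rK rOne)
       (row_loop add_body ;; Add rX rSet rI ;; Store rX rOne)"

text \<open>The last line is no candidate and forms the initial stack, hence the height 1. Its
  address is found by adding the stride once per line above it.\<close>

definition pass :: com where
  "pass = Sub rI rM rOne ;; Move rB rBase ;; Const rJ 0 ;;
     WhileLess rJ rI (Add rB rB rRS ;; Add rJ rJ rOne) ;;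
     Move rA rB ;; Const rK 1 ;; WhileLess rZero rI pass_step ;; Move rM rK ;; Move rBase rB"

lemma writes_pass_step:
  "writes pass_step = {rI, rA, rB, rK, rX, rY, rJ, rU, rV, rCount}"
  by (auto simp: pass_step_def row_loop_def count_body_def copy_body_def add_body_def)

lemma writes_pass:
  "writes pass = {rBase, rM, rI, rA, rB, rK, rX, rY, rJ, rU, rV, rCount}"
  unfolding pass_def writes.simps writes_pass_step by auto

text \<open>The layout enters through injectivity of \<open>adr\<close> and the enclosing interval
  from \<open>lo\<close> to \<open>hi\<close>, not through concrete strides, so the lemma covers
  lines and columns alike. The marks lie above \<open>hi\<close>, where moving lines cannot disturb
  them. The \<open>20 * n\<close> is for two row loops: the count, then a copy or an
  addition.\<close>

lemma pass_step:
  fixes m n b rs cs sb lo hi :: nat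
  defines "adr \<equiv> \<lambda>r c. b + r * rs + c * cs"
  assumes regs: "reg s rOne = 1" "reg s rZero = 0" "reg s rRS = rs" "reg s rCS = cs" "reg s rN = n"
      "reg s rSet = sb" "reg s rI = Suc i" "reg s rA = b + Suc i * rs" "reg s rB = b + d * rs"
      "reg s rK = m - d"
    and bounds: "b + m * rs + n * cs \<le> W" "sb + m \<le> W" "m \<le> W" "n \<le> W" "2 \<le> W"
    and inj: "\<And>r c r' c'. r < m \<Longrightarrow> c < n \<Longrightarrow> r' < m \<Longrightarrow> c' < n \<Longrightarrow> adr r c = adr r' c' \<Longrightarrow>
      r = r' \<and> c = c'"
    and region: "\<And>r c. r < m \<Longrightarrow> c < n \<Longrightarrow> lo \<le> adr r c \<and> adr r c < hi" "hi \<le> sb"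
    and cs: "0 < cs"
    and st: "stacked adr m n (Suc i) d (mem s) C"
    and bin: "binary_mat C"
    and S: "S \<subseteq> {Suc i..<m - 1}" "\<And>x. x < m - 1 \<Longrightarrow> mem s (sb + x) = (if x \<in> S then 1 else 0)"
    and C': "line_step i (C, S) = (C', S')"
  shows "runs W pass_step s (\<lambda>t s'. t \<le> 20 * n + 15 \<and> reg s' rI = i \<and> reg s' rA = b + i * rs \<and>
    (\<exists>d'. reg s' rB = b + d' * rs \<and> reg s' rK = m - d' \<and> stacked adr m n i d' (mem s') C') \<and>
    binary_mat C' \<and> S' \<subseteq> {i..<m - 1} \<and>
    (\<forall>x<m - 1. mem s' (sb + x) = (if x \<in> S' then 1 else 0)) \<and>
    (\<forall>x. \<not> (lo \<le> x \<and> x < hi) \<longrightarrow> \<not> (sb \<le> x \<and> x < sb + (m - 1)) \<longrightarrow> mem s' x = mem s x))"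
proof -
  let ?Y = "{rX, rY, rJ, rU, rV, rCount}"
  define s1 where "s1 = set_reg rCount 0 (set_reg rA (b + i * rs) (set_reg rI i s))"
  have s1: "reg s1 = (reg s)(rI := i, rA := b + i * rs, rCount := 0)" "mem s1 = mem s"
    by (simp_all add: s1_def state_simps)
  have d: "i < d" "d < m" "dim_row C = Suc i + (m - d)" "dim_col C = n"
    using st unfolding stacked_def by auto
  have row_i: "mem s (b + i * rs + c * cs) = C $$ (i, c)" if "c < n" for c
    using st that unfolding stacked_def adr_def by simp
  have row_d: "mem s (b + d * rs + c * cs) = C $$ (Suc i, c)" if "c < n" for c
    using st that d(2) unfolding stacked_def adr_def by (auto dest: spec[of _ 0])
  have binC: "C $$ (i, c) \<le> 1" "C $$ (Suc i, c) \<le> 1" if "c < n" for c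
    using bin that d unfolding binary_mat_iff by auto
  have W: "b + r * rs + n * cs \<le> W" if "r < m" for r
    using bounds(1) that mult_le_mono1[of r m rs] by linarith
  let ?sum = "\<Sum>j<n. C $$ (i, j) * C $$ (Suc i, j)"
  have valid: "binary_mat (contract_line i C) \<longleftrightarrow> ?sum = 0"
    using binary_contract_line[OF bin, of i] d by simp
  have count: "runs W (row_loop count_body) s1 (\<lambda>t s'. t \<le> 10 * n + 4 \<and> mem s' = mem s \<and>
    reg s' rCount = ?sum \<and> agree ?Y s1 s')"
  proof (rule runs_weaken[OF row_count[where cs=cs]])
    show "reg s1 rOne = 1" "reg s1 rA = b + i * rs" "reg s1 rB = b + d * rs" "reg s1 rCS = cs"
      "reg s1 rN = n"
      using regs by (simp_all add: s1)
    show "b + i * rs + n * cs \<le> W" "b + d * rs + n * cs \<le> W" using W d by auto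
    show "reg s1 rCount + n \<le> W" "2 \<le> W" using bounds by (simp_all add: s1)
  qed (use binC in \<open>simp_all add: s1 row_i row_d\<close>)
  have "runs W (row_loop count_body) s1 (\<lambda>t s2. runs W (IfLess rZero rCount
       (Sub rB rB rRS ;; row_loop copy_body ;; Add rK rK rOne)
       (row_loop add_body ;; Add rX rSet rI ;; Store rX rOne)) s2
    (\<lambda>t' s'. t + t' \<le> 20 * n + 12 \<and> reg s' rI = i \<and> reg s' rA = b + i * rs \<and>
    (\<exists>d'. reg s' rB = b + d' * rs \<and> reg s' rK = m - d' \<and> stacked adr m n i d' (mem s') C') \<and>
    binary_mat C' \<and> S' \<subseteq> {i..<m - 1} \<and>
    (\<forall>x<m - 1. mem s' (sb + x) = (if x \<in> S' then 1 else 0)) \<and>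
    (\<forall>x. \<not> (lo \<le> x \<and> x < hi) \<longrightarrow> \<not> (sb \<le> x \<and> x < sb + (m - 1)) \<longrightarrow> mem s' x = mem s x)))"
    (is "runs W _ s1 (\<lambda>t s2. runs W ?if s2 (\<lambda>t' s'. t + t' \<le> _ \<and> ?post s'))")
  proof (rule runs_weaken[OF count], elim conjE)
    fix t :: nat and s2 :: ram
    assume t: "t \<le> 10 * n + 4" and m2: "mem s2 = mem s" and c2: "reg s2 rCount = ?sum"
      and ag: "agree ?Y s1 s2"
    have regs2: "reg s2 rOne = 1" "reg s2 rZero = 0" "reg s2 rRS = rs" "reg s2 rCS = cs"
      "reg s2 rN = n" "reg s2 rSet = sb" "reg s2 rI = i" "reg s2 rA = b + i * rs"
      "reg s2 rB = b + d * rs" "reg s2 rK = m - d"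
      using regs by (simp_all add: agree_reg[OF ag] s1)
    show "runs W ?if s2 (\<lambda>t' s'. t + t' \<le> 20 * n + 12 \<and> ?post s')"
    proof (cases "?sum = 0")
      case True
      then have C'_eq: "C' = contract_line i C" "S' = insert i S"
        using C' valid by (auto simp: line_step_def)
      have "runs W (row_loop add_body) s2 (\<lambda>t s'. t \<le> 10 * n + 4 \<and> reg s' rCount = reg s2 rCount \<and>
        (\<forall>j<n. mem s' (b + d * rs + j * cs) = mem s2 (b + i * rs + j * cs) + mem s2 (b + d * rs + j * cs)) \<and>
        (\<forall>x. (\<forall>j<n. x \<noteq> b + d * rs + j * cs) \<longrightarrow> mem s' x = mem s2 x) \<and> agree ?Y s2 s')"
      proof (rule row_add[where cs=cs])
        show "b + i * rs + n * cs \<le> W" "b + d * rs + n * cs \<le> W" using W d by auto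
        show "b + i * rs + k * cs \<noteq> b + d * rs + j * cs" if "j < n" "k < n" for j k
          using inj[of i k d j] that d by (auto simp: adr_def)
        show "mem s2 (b + i * rs + j * cs) + mem s2 (b + d * rs + j * cs) \<le> W" if "j < n" for j
          using binC[OF that] bounds by (simp add: m2 row_i row_d that)
      qed (use regs2 bounds cs in auto)
      then have "runs W (row_loop add_body) s2 (\<lambda>t1 s3. runs W (Add rX rSet rI ;; Store rX rOne) s3
        (\<lambda>t2 s'. t + (1 + (t1 + t2)) \<le> 20 * n + 12 \<and> ?post s'))"
      proof (rule runs_weaken, elim conjE)
        fix t1 :: nat and s3 :: ram
        assume t1: "t1 \<le> 10 * n + 4" and ag3: "agree ?Y s2 s3"
          and new: "\<forall>j<n. mem s3 (b + d * rs + j * cs) =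
            mem s2 (b + i * rs + j * cs) + mem s2 (b + d * rs + j * cs)"
          and old: "\<forall>x. (\<forall>j<n. x \<noteq> b + d * rs + j * cs) \<longrightarrow> mem s3 x = mem s2 x"
        have old': "mem s3 x = mem s x" if "\<not> (lo \<le> x \<and> x < hi)" for x
          using old region(1)[OF d(2)] that m2 unfolding adr_def by metis
        have "stacked adr m n i d (mem s3) C'"
          unfolding C'_eq
        proof (rule stacked_merge[OF st])
          show "\<forall>c<n. mem s3 (adr d c) = mem s (adr i c) + mem s (adr d c)"
            using new m2 by (simp add: adr_def)
          show "mem s3 (adr r c) = mem s (adr r c)" if "r < m" "r \<noteq> d" "c < n" for r c
          proof -
          have "\<forall>j<n. adr r c \<noteq> adr d j" using inj[of r c d] that d(2) by blast
          then show ?thesis using old m2 by (simp add: adr_def)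
        qed
        qed
        \<comment> \<open>The new mark at \<open>sb + i\<close> lies outside the matrix because
          \<open>hi <= sb\<close>.\<close>
        define \<mu> where "\<mu> = (mem s3)(sb + i := 1)"
        have "stacked adr m n i d \<mu> C'"
          unfolding \<mu>_def by (rule stacked_cong) (use \<open>stacked adr m n i d (mem s3) C'\<close> region in fastforce)+
        moreover have "\<forall>x<m - 1. \<mu> (sb + x) = (if x \<in> S' then 1 else 0)"
          using S(2) old' region(2) by (simp add: C'_eq \<mu>_def)
        moreover have "\<forall>x. \<not> (lo \<le> x \<and> x < hi) \<longrightarrow> \<not> (sb \<le> x \<and> x < sb + (m - 1)) \<longrightarrow> \<mu> x = mem s x"
          using old' d by (auto simp: \<mu>_def)
        moreover have "binary_mat C'" "S' \<subseteq> {i..<m - 1}"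
          using True valid S(1) d by (auto simp: C'_eq)
        moreover have "sb + i \<le> W" "t + (1 + (t1 + 2)) \<le> 20 * n + 12"
          using bounds(2) d t t1 by auto
        moreover define s' where "s' = set_mem (sb + i) 1 (set_reg rX (sb + i) s3)"
        moreover have "reg s' rI = i" "reg s' rA = b + i * rs" "reg s' rB = b + d * rs"
          "reg s' rK = m - d" "mem s' = \<mu>"
          by (simp_all add: s'_def state_simps agree_reg[OF ag3] regs2 \<mu>_def)
        ultimately have "sb + i \<le> W \<and> t + (1 + (t1 + 2)) \<le> 20 * n + 12 \<and> ?post s'" by blast
        moreover have "runs W (Add rX rSet rI ;; Store rX rOne) s3 Q \<longleftrightarrow> sb + i \<le> W \<and> Q 2 s'" for Q
          by (simp add: step_simps agree_reg[OF ag3] regs2 s'_def one_add_one del: One_nat_def)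
        ultimately show "runs W (Add rX rSet rI ;; Store rX rOne) s3
          (\<lambda>t2 s'. t + (1 + (t1 + t2)) \<le> 20 * n + 12 \<and> ?post s')"
          by blast
      qed
      then show ?thesis
        by (simp only: runs_simps(8) runs_Seq regs2 c2 True less_irrefl if_False)
    next
      case False
      then have "\<not> binary_mat (contract_line i C)" using valid by metis
      then have C'_eq: "C' = C" "S' = S"
        using C' by (auto simp: line_step_def)
      \<comment> \<open>The new top goes to the slot just above the old one. The case
        \<open>e = i\<close> can occur and makes the copy a copy onto itself.\<close>
      obtain e where e: "d = Suc e" "i \<le> e" "e < m" using d by (cases d) auto
      define s3 where "s3 = set_reg rB (b + e * rs) s2"
      have s3: "reg s3 = (reg s2)(rB := b + e * rs)" "mem s3 = mem s"
        by (simp_all add: s3_def state_simps m2)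
      have "runs W (row_loop copy_body) s3 (\<lambda>t s'. t \<le> 10 * n + 4 \<and> reg s' rCount = reg s3 rCount \<and>
        (\<forall>j<n. mem s' (b + e * rs + j * cs) = mem s3 (b + i * rs + j * cs)) \<and>
        (\<forall>x. (\<forall>j<n. x \<noteq> b + e * rs + j * cs) \<longrightarrow> mem s' x = mem s3 x) \<and> agree ?Y s3 s')"
      proof (rule row_copy[where cs=cs])
        show "b + i * rs + n * cs \<le> W" "b + e * rs + n * cs \<le> W" using W d e by auto
        show "k = j" if "j < n" "k < n" "b + i * rs + k * cs = b + e * rs + j * cs" for j k
          using inj[of i k e j] that d e by (auto simp: adr_def)
      qed (use regs2 bounds cs in \<open>auto simp: s3\<close>)
      then have "runs W (row_loop copy_body) s3 (\<lambda>t1 s4. runs W (Add rK rK rOne) s4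
        (\<lambda>t2 s'. t + (1 + (1 + (t1 + t2))) \<le> 20 * n + 12 \<and> ?post s'))"
      proof (rule runs_weaken, elim conjE)
        fix t1 :: nat and s4 :: ram
        assume t1: "t1 \<le> 10 * n + 4" and ag4: "agree ?Y s3 s4"
          and new: "\<forall>j<n. mem s4 (b + e * rs + j * cs) = mem s3 (b + i * rs + j * cs)"
          and old: "\<forall>x. (\<forall>j<n. x \<noteq> b + e * rs + j * cs) \<longrightarrow> mem s4 x = mem s3 x"
        have old': "mem s4 x = mem s x" if "\<not> (lo \<le> x \<and> x < hi)" for x
          using old region(1)[OF e(3)] that s3 unfolding adr_def by metis
        have "stacked adr m n i e (mem s4) C'"
          unfolding C'_eq
        proof (rule stacked_push[OF st[unfolded e(1)]])
          show "\<forall>c<n. mem s4 (adr e c) = mem s (adr i c)"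
            using new s3 by (simp add: adr_def)
          show "mem s4 (adr r c) = mem s (adr r c)" if "r < m" "r \<noteq> e" "c < n" for r c
          proof -
          have "\<forall>j<n. adr r c \<noteq> adr e j" using inj[of r c e] that e(3) by blast
          then show ?thesis using old s3 by (simp add: adr_def)
        qed
        qed
        moreover have "\<forall>x<m - 1. mem s4 (sb + x) = (if x \<in> S' then 1 else 0)"
          using S(2) old' region(2) by (simp add: C'_eq)
        moreover have "\<forall>x. \<not> (lo \<le> x \<and> x < hi) \<longrightarrow> \<not> (sb \<le> x \<and> x < sb + (m - 1)) \<longrightarrow> mem s4 x = mem s x"
          using old' by blast
        moreover have "binary_mat C'" "S' \<subseteq> {i..<m - 1}"
          using bin S(1) d by (auto simp: C'_eq)
        moreover have "m - d + 1 = m - e" "m - e \<le> W" "t + (1 + (1 + (t1 + 1))) \<le> 20 * n + 12"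
          using e d t t1 bounds(3) by auto
        ultimately show "runs W (Add rK rK rOne) s4
          (\<lambda>t2 s'. t + (1 + (1 + (t1 + t2))) \<le> 20 * n + 12 \<and> ?post s')"
          by (auto simp: step_simps agree_reg[OF ag4] regs2 s3(1) simp del: One_nat_def
              intro!: exI[of _ e])
      qed
      moreover have "b + d * rs - rs = b + e * rs" by (simp add: e)
      ultimately show ?thesis
        by (simp only: runs_simps(5,8) runs_Seq regs2 c2 s3_def False[unfolded neq0_conv] if_True)
    qed
  qed
  then have "runs W (row_loop count_body) s1 (\<lambda>t s2. runs W ?if s2
      (\<lambda>t' s'. 1 + (1 + (1 + (t + t'))) \<le> 20 * n + 15 \<and> ?post s'))"
    by (rule runs_weaken, elim runs_weaken) auto
  moreover have "b + Suc i * rs - rs = b + i * rs" by simp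
  ultimately show ?thesis
    unfolding pass_step_def runs_Seq runs_simps(2,5) by (simp add: regs state_simps s1_def)
qed

text \<open>The lower end of the region stays fixed while its upper end sinks by one stride per
  contraction; this gives the new base. The bound is a multiple of \<open>m * n\<close> because
  \<open>0 < n\<close> absorbs the constant cost per line and \<open>0 < m\<close> the constant cost
  of the pass.\<close>

lemma pass:
  fixes b rs cs sb lo hi :: nat and A :: "nat mat"
  defines "m \<equiv> dim_row A" and "n \<equiv> dim_col A" and "adr \<equiv> \<lambda>r c. b + r * rs + c * cs"
  assumes regs: "reg s rOne = 1" "reg s rZero = 0" "reg s rBase = b" "reg s rRS = rs"
      "reg s rCS = cs" "reg s rM = m" "reg s rN = n" "reg s rSet = sb"
    and bounds: "b + m * rs + n * cs \<le> W" "sb + m \<le> W" "m \<le> W" "n \<le> W" "2 \<le> W"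
    and pos: "0 < m" "0 < n" "0 < cs"
    and inj: "\<And>r c r' c'. r < m \<Longrightarrow> c < n \<Longrightarrow> r' < m \<Longrightarrow> c' < n \<Longrightarrow> adr r c = adr r' c' \<Longrightarrow>
      r = r' \<and> c = c'"
    and region: "\<And>r c. r < m \<Longrightarrow> c < n \<Longrightarrow> lo \<le> adr r c \<and> adr r c < hi" "hi \<le> sb"
    and A: "laid_out (mem s) b rs cs A" "binary_mat A"
    and zero: "\<And>x. x < m - 1 \<Longrightarrow> mem s (sb + x) = 0"
    and C: "line_pass A = (C, S)"
  shows "runs W pass s (\<lambda>t s'. t \<le> 48 * (m * n) \<and> 0 < dim_row C \<and> dim_row C \<le> m \<and> dim_col C = n \<and>
    binary_mat C \<and> S \<subseteq> {..<m - 1} \<and> reg s' rM = dim_row C \<and>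
    reg s' rBase = b + (m - dim_row C) * rs \<and> laid_out (mem s') (reg s' rBase) rs cs C \<and>
    (\<forall>x<m - 1. mem s' (sb + x) = (if x \<in> S then 1 else 0)) \<and>
    (\<forall>x. \<not> (lo \<le> x \<and> x < hi) \<longrightarrow> \<not> (sb \<le> x \<and> x < sb + (m - 1)) \<longrightarrow> mem s' x = mem s x) \<and>
    agree (writes pass) s s')"
proof -
  let ?dims = "0 < dim_row C \<and> dim_row C \<le> m \<and> dim_col C = n \<and> binary_mat C \<and> S \<subseteq> {..<m - 1}"
  let ?post = "\<lambda>s'. reg s' rM = dim_row C \<and>
    reg s' rBase = b + (m - dim_row C) * rs \<and> laid_out (mem s') (reg s' rBase) rs cs C \<and>
    (\<forall>x<m - 1. mem s' (sb + x) = (if x \<in> S then 1 else 0)) \<and>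
    (\<forall>x. \<not> (lo \<le> x \<and> x < hi) \<longrightarrow> \<not> (sb \<le> x \<and> x < sb + (m - 1)) \<longrightarrow> mem s' x = mem s x)"
  let ?down = "Add rB rB rRS ;; Add rJ rJ rOne"
  define s1 where "s1 = set_reg rJ 0 (set_reg rB b (set_reg rI (m - 1) s))"
  have s1: "reg s1 = (reg s)(rI := m - 1, rB := b, rJ := 0)" "mem s1 = mem s"
    by (simp_all add: s1_def state_simps)
  have down: "runs W (WhileLess rJ rI ?down) s1 (\<lambda>t s'. t \<le> (m - 1) * (2 + 1) + 1 \<and>
      (reg s' rB = b + (m - 1) * rs \<and> reg s' rJ = m - 1 \<and> mem s' = mem s) \<and>
      agree (writes ?down) s1 s')"
  proof (rule runs_for[where I = "\<lambda>k s'. reg s' rB = b + k * rs \<and> reg s' rJ = k \<and> mem s' = mem s"])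
    fix k :: nat and s' :: ram
    assume k: "k < m - 1" and I: "reg s' rB = b + k * rs \<and> reg s' rJ = k \<and> mem s' = mem s"
      and ag: "agree (writes ?down) s1 s'"
    have eqs: "reg s' rOne = 1" "reg s' rRS = rs" "reg s' rI = m - 1"
      using regs by (simp_all add: agree_reg[OF ag] s1)
    have "Suc k * rs \<le> m * rs" using k by (intro mult_le_mono1) simp
    then show "reg s' rJ < reg s' rI \<and> runs W ?down s' (\<lambda>t s''. t \<le> 2 \<and>
        reg s'' rB = b + Suc k * rs \<and> reg s'' rJ = Suc k \<and> mem s'' = mem s)"
      using k I eqs bounds by (simp add: step_simps)
  next
    fix s' :: ram assume I: "reg s' rB = b + (m - 1) * rs \<and> reg s' rJ = m - 1 \<and> mem s' = mem s"
      and ag: "agree (writes ?down) s1 s'"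
    show "\<not> reg s' rJ < reg s' rI" using I by (simp add: agree_reg[OF ag] s1)
  qed (simp add: s1)
  let ?frame = "\<lambda>s'. \<forall>x. \<not> (lo \<le> x \<and> x < hi) \<longrightarrow> \<not> (sb \<le> x \<and> x < sb + (m - 1)) \<longrightarrow> mem s' x = mem s x"
  \<comment> \<open>\<open>k\<close> counts the processed candidates. The top slot \<open>d\<close>
    is existential because it depends on how many contractions have succeeded.\<close>
  define I where "I = (\<lambda>k (s' :: ram). reg s' rI = m - 1 - k \<and> reg s' rA = b + (m - 1 - k) * rs \<and>
    (\<exists>d. reg s' rB = b + d * rs \<and> reg s' rK = m - d \<and>
      stacked adr m n (m - 1 - k) d (mem s') (fst (line_steps A k))) \<and>
    binary_mat (fst (line_steps A k)) \<and> snd (line_steps A k) \<subseteq> {m - 1 - k..<m - 1} \<and>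
    (\<forall>x<m - 1. mem s' (sb + x) = (if x \<in> snd (line_steps A k) then 1 else 0)) \<and> ?frame s')"
  have loop: "runs W (WhileLess rZero rI pass_step) s2 (\<lambda>t s'. t \<le> (m - 1) * (20 * n + 15 + 1) + 1 \<and>
      I (m - 1) s' \<and> agree (writes pass_step) s2 s')"
    if s2: "I 0 s2" and regs2: "reg s2 rOne = 1" "reg s2 rZero = 0" "reg s2 rRS = rs" "reg s2 rCS = cs"
      "reg s2 rN = n" "reg s2 rSet = sb" for s2 :: ram
  proof (rule runs_for[where I = I, OF s2])
    fix k :: nat and s' :: ram
    assume k: "k < m - 1" and Ik: "I k s'" and "agree (writes pass_step) s2 s'"
    then have ag: "agree {rI, rA, rB, rK, rX, rY, rJ, rU, rV, rCount} s2 s'"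
      by (simp only: writes_pass_step)
    have regs': "reg s' rOne = 1" "reg s' rZero = 0" "reg s' rRS = rs" "reg s' rCS = cs"
      "reg s' rN = n" "reg s' rSet = sb"
      using regs2 by (simp_all add: agree_reg[OF ag])
    obtain i where i: "m - 1 - k = Suc i" "m - 1 - Suc k = i" using k
      by (metis Suc_diff_Suc)
    obtain D R where D: "line_steps A k = (D, R)" by fastforce
    obtain D' R' where D': "line_step i (D, R) = (D', R')" by fastforce
    have Suc: "line_steps A (Suc k) = (D', R')"
      using line_steps_Suc[of A k i] i D D' by (simp add: m_def)
    from Ik obtain d where Ik': "reg s' rI = Suc i" "reg s' rA = b + Suc i * rs"
        "reg s' rB = b + d * rs" "reg s' rK = m - d" "stacked adr m n (Suc i) d (mem s') D"
        "binary_mat D" "R \<subseteq> {Suc i..<m - 1}"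
        "\<And>x. x < m - 1 \<Longrightarrow> mem s' (sb + x) = (if x \<in> R then 1 else 0)" "?frame s'"
      unfolding I_def i D by auto
    have "runs W pass_step s' (\<lambda>t s''. t \<le> 20 * n + 15 \<and> I (Suc k) s'')"
      by (rule runs_weaken[OF pass_step[where b = b and cs = cs and lo = lo and hi = hi,
            OF regs' Ik'(1-4) bounds inj[unfolded adr_def] region[unfolded adr_def] pos(3)
              Ik'(5)[unfolded adr_def] Ik'(6-8) D']])
         (unfold I_def i(2) Suc fst_conv snd_conv adr_def, use Ik'(9) in auto)
    then show "reg s' rZero < reg s' rI \<and> runs W pass_step s' (\<lambda>t s''. t \<le> 20 * n + 15 \<and> I (Suc k) s'')"
      using regs' Ik' by simp
  qed (simp add: I_def)
  \<comment> \<open>After the last candidate no line is left above the stack, so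
    \<open>dim_row C = m - d\<close> and slot \<open>d\<close> is the new base.\<close>
  have fin: "?dims \<and> ?post (set_reg rBase (reg s' rB) (set_reg rM (reg s' rK) s'))" if "I (m - 1) s'" for s'
  proof -
    from that obtain d where d: "reg s' rB = b + d * rs" "reg s' rK = m - d"
        "stacked adr m n 0 d (mem s') C"
        "binary_mat C" "S \<subseteq> {0..<m - 1}"
        "\<forall>x<m - 1. mem s' (sb + x) = (if x \<in> S then 1 else 0)" "?frame s'"
      unfolding I_def using C by (auto simp: line_pass_steps m_def)
    then show ?thesis
      unfolding stacked_def by (auto simp: state_simps laid_out_def adr_def algebra_simps)
  qed
  have "runs W (WhileLess rJ rI ?down) s1 (\<lambda>t s'. runs W (WhileLess rZero rI pass_step)
    (set_reg rK 1 (set_reg rA (reg s' rB) s')) (\<lambda>t' s'. 1 + (1 + (1 + (t + (1 + (1 + (t' + (1 + 1))))))) \<le> 48 * (m * n) \<and>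
      ?dims \<and> ?post (set_reg rBase (reg s' rB) (set_reg rM (reg s' rK) s'))))"
  proof (rule runs_weaken[OF down], elim conjE)
    fix t :: nat and s' :: ram
    assume t: "t \<le> (m - 1) * (2 + 1) + 1" and s': "reg s' rB = b + (m - 1) * rs" "mem s' = mem s"
      and ag: "agree (writes ?down) s1 s'"
    let ?s = "set_reg rK 1 (set_reg rA (reg s' rB) s')"
    \<comment> \<open>Before the first step the stack is the last line alone, in its original
      slot.\<close>
    have "stacked adr m n (m - 1) (m - 1) (mem s) A"
      using A(1) pos unfolding stacked_def laid_out_def adr_def m_def n_def by auto
    then have "I 0 ?s"
      using A pos zero s' unfolding I_def line_steps_0
      by (auto simp: state_simps agree_reg[OF ag] s1 intro!: exI[of _ "m - 1"])
    then have "runs W (WhileLess rZero rI pass_step) ?s (\<lambda>t s'. t \<le> (m - 1) * (20 * n + 15 + 1) + 1 \<and>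
      I (m - 1) s' \<and> agree (writes pass_step) ?s s')"
      by (rule loop) (use regs in \<open>simp_all add: state_simps agree_reg[OF ag] s1\<close>)
    then show "runs W (WhileLess rZero rI pass_step) ?s (\<lambda>t' s'.
      1 + (1 + (1 + (t + (1 + (1 + (t' + (1 + 1))))))) \<le> 48 * (m * n) \<and>
      ?dims \<and> ?post (set_reg rBase (reg s' rB) (set_reg rM (reg s' rK) s')))"
    proof (rule runs_weaken, elim conjE)
      fix t' :: nat and s' :: ram
      assume t': "t' \<le> (m - 1) * (20 * n + 15 + 1) + 1" and "I (m - 1) s'"
      \<comment> \<open>Successors remove the truncated subtraction \<open>m - 1\<close>; the bound
        is then a comparison of coefficients.\<close>
      obtain m' n' where "m = Suc m'" "n = Suc n'" using pos by (metis gr0_implies_Suc)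
      then have "1 + (1 + (1 + (t + (1 + (1 + (t' + (1 + 1))))))) \<le> 48 * (m * n)"
        using t t' by (simp add: algebra_simps)
      with fin[OF \<open>I (m - 1) s'\<close>]
      show "1 + (1 + (1 + (t + (1 + (1 + (t' + (1 + 1))))))) \<le> 48 * (m * n) \<and>
        ?dims \<and> ?post (set_reg rBase (reg s' rB) (set_reg rM (reg s' rK) s'))" by blast
    qed
  qed
  then have "runs W pass s (\<lambda>t s'. t \<le> 48 * (m * n) \<and> ?dims \<and> ?post s')"
    unfolding pass_def runs_Seq runs_simps(2,3,5)
    using bounds by (simp add: regs state_simps s1_def split del: if_split)
  then show ?thesis
    by (rule runs_weaken[OF runs_agree]) blast
qed

section \<open>Columns as lines of the transposed matrix\<close>

lemma contract_col_transpose: "contract_col j A = transpose_mat (contract_line j (transpose_mat A))"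
  by (rule eq_matI) (auto simp: contract_col_def contract_line_def)

lemma binary_mat_transpose: "binary_mat (transpose_mat A) \<longleftrightarrow> binary_mat A"
  unfolding binary_mat_iff by auto

lemma laid_out_transpose: "laid_out \<mu> b cs rs (transpose_mat A) \<longleftrightarrow> laid_out \<mu> b rs cs A"
  unfolding laid_out_def by (auto simp: add.assoc add.commute[of "i * cs" "j * rs" for i j])

lemma col_step_transpose:
  "col_step j (transpose_mat A, S) = map_prod transpose_mat id (line_step j (A, S))"
  by (simp add: col_step_def line_step_def contract_col_transpose binary_mat_transpose)

text \<open>Each column step is a line step seen through transposition and records the same index,
  so the two folds simulate each other. Starting the induction from a transposed matrix loses
  nothing, as transposition is an involution.\<close>

lemma col_pass_transpose: "col_pass A = map_prod transpose_mat id (line_pass (transpose_mat A))"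
proof -
  have "fold col_step is (transpose_mat A, S) = map_prod transpose_mat id (fold line_step is (A, S))" for "is" A S
  proof (induction "is" arbitrary: A S)
    case (Cons i "is")
    then show ?case by (cases "line_step i (A, S)") (simp add: col_step_transpose)
  qed simp
  from this[of _ "transpose_mat A" "{}"] show ?thesis
    by (simp add: col_pass_def line_pass_def)
qed

lemma LC_part_transpose:
  "LC_part A = (let (B, L) = line_pass A; (D, C) = line_pass (transpose_mat B) in (transpose_mat D, L, C))"
  by (simp add: LC_part_def col_pass_transpose Let_def split: prod.split)

text \<open>Lines contracted in the transpose are columns of \<open>M\<close>, hence the exchange of
  the two sets. This is what allows one program to serve for both orders.\<close>

lemma CL_part_transpose:
  "CL_part M = (let (B, L, C) = LC_part (transpose_mat M) in (transpose_mat B, C, L))"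
  by (simp add: CL_part_def LC_part_def col_pass_transpose Let_def split: prod.split)

section \<open>Density\<close>

text \<open>Both ends carry an offset so that no direction needs subtraction: down left pairs
  \<open>(i, j + 1)\<close> with \<open>(i + 1, j)\<close>. The window of \<open>m\<close> by
  \<open>n\<close> cells is chosen by the user so that neither end leaves the matrix.\<close>

definition shift_sum :: "nat mat \<Rightarrow> nat \<Rightarrow> nat \<Rightarrow> nat \<Rightarrow> nat \<Rightarrow> nat \<Rightarrow> nat \<Rightarrow> nat" where
  "shift_sum A a b c d m n = (\<Sum>i<m. \<Sum>j<n. A $$ (i + a, j + b) * A $$ (i + c, j + d))"

definition shift_pairs :: "nat mat \<Rightarrow> nat \<Rightarrow> nat \<Rightarrow> nat \<Rightarrow> nat \<Rightarrow> nat \<Rightarrow> nat \<Rightarrow> ((nat \<times> nat) \<times> nat \<times> nat) set" where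
  "shift_pairs A a b c d m n = (\<lambda>(i, j). ((i + a, j + b), (i + c, j + d))) `
     {(i, j) \<in> {..<m} \<times> {..<n}. A $$ (i + a, j + b) = 1 \<and> A $$ (i + c, j + d) = 1}"

lemma finite_shift_pairs: "finite (shift_pairs A a b c d m n)"
  unfolding shift_pairs_def by (auto intro: finite_subset[of _ "{..<m} \<times> {..<n}"])

text \<open>For bits, the product is the indicator of both being 1.\<close>

lemma card_shift_pairs:
  assumes "binary_mat A" "m + a \<le> dim_row A" "m + c \<le> dim_row A" "n + b \<le> dim_col A" "n + d \<le> dim_col A"
  shows "card (shift_pairs A a b c d m n) = shift_sum A a b c d m n"
proof -
  let ?P = "\<lambda>x. A $$ (fst x + a, snd x + b) = 1 \<and> A $$ (fst x + c, snd x + d) = 1"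
  have "card (shift_pairs A a b c d m n) = card {x \<in> {..<m} \<times> {..<n}. ?P x}"
    unfolding shift_pairs_def by (subst card_image) (auto simp: inj_on_def intro!: arg_cong[where f = card])
  also have "\<dots> = (\<Sum>x\<in>{..<m} \<times> {..<n}. if ?P x then 1 else 0)"
    by (simp add: sum.If_cases Int_def)
  also have "\<dots> = (\<Sum>x\<in>{..<m} \<times> {..<n}. A $$ (fst x + a, snd x + b) * A $$ (fst x + c, snd x + d))"
  proof (rule sum.cong[OF refl])
    fix x assume "x \<in> {..<m} \<times> {..<n}"
    then have "A $$ (fst x + a, snd x + b) \<le> 1" "A $$ (fst x + c, snd x + d) \<le> 1"
      using assms unfolding binary_mat_iff by auto
    then show "(if ?P x then 1 else 0) = A $$ (fst x + a, snd x + b) * A $$ (fst x + c, snd x + d)"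
      by (auto simp: le_Suc_eq)
  qed
  finally show ?thesis
    by (simp add: shift_sum_def sum.cartesian_product case_prod_beta)
qed

text \<open>Every unordered pair of neighbours is ordered so that the second one is the later in row order.\<close>

lemma density_shift_sum:
  assumes "binary_mat A" "dim_row A = Suc m" "dim_col A = Suc n"
  shows "density A = shift_sum A 0 0 0 1 (Suc m) n + shift_sum A 0 0 1 0 m (Suc n) +
    shift_sum A 0 0 1 1 m n + shift_sum A 0 1 1 0 m n"
proof -
  let ?F1 = "shift_pairs A 0 0 0 1 (Suc m) n" and ?F2 = "shift_pairs A 0 0 1 0 m (Suc n)"
  let ?F3 = "shift_pairs A 0 0 1 1 m n" and ?F4 = "shift_pairs A 0 1 1 0 m n"
  let ?F = "?F1 \<union> ?F2 \<union> ?F3 \<union> ?F4"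
  let ?D = "{{(i, j), (i', j')} | i j i' j'.
     (i, j) \<in> one_positions A \<and> (i', j') \<in> one_positions A \<and>
     max \<bar>int i - int i'\<bar> \<bar>int j - int j'\<bar> = 1}"
  \<comment> \<open>Each window is exactly as large as the matrix permits, so the window conditions
    amount to both positions lying in the matrix.\<close>
  have F: "((i, j), (i', j')) \<in> ?F \<longleftrightarrow> (i, j) \<in> one_positions A \<and> (i', j') \<in> one_positions A \<and>
      (i' = i \<and> j' = Suc j \<or> i' = Suc i \<and> (j' = j \<or> j' = Suc j \<or> j = Suc j'))" for i j i' j'
    using assms(2,3) by (auto simp: shift_pairs_def one_positions_def image_iff)
  have "?D = (\<lambda>(x, y). {x, y}) ` ?F"
  proof (intro equalityI subsetI)
    fix X assume "X \<in> ?D"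
    then obtain i j i' j' where X: "X = {(i, j), (i', j')}" and
      ones: "(i, j) \<in> one_positions A" "(i', j') \<in> one_positions A" and
      "max \<bar>int i - int i'\<bar> \<bar>int j - int j'\<bar> = 1" by blast
    then have "(i' = i \<and> j' = Suc j \<or> i' = Suc i \<and> (j' = j \<or> j' = Suc j \<or> j = Suc j')) \<or>
      (i = i' \<and> j = Suc j' \<or> i = Suc i' \<and> (j = j' \<or> j = Suc j' \<or> j' = Suc j))"
      by (auto simp: max_def abs_if split: if_splits)
    then have "((i, j), (i', j')) \<in> ?F \<or> ((i', j'), (i, j)) \<in> ?F"
      using ones F by blast
    then show "X \<in> (\<lambda>(x, y). {x, y}) ` ?F"
    proof
      assume "((i, j), (i', j')) \<in> ?F"
      then show ?thesis unfolding X by (rule rev_image_eqI) simp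
    next
      assume "((i', j'), (i, j)) \<in> ?F"
      then show ?thesis unfolding X by (rule rev_image_eqI) (simp add: insert_commute)
    qed
  next
    fix X assume "X \<in> (\<lambda>(x, y). {x, y}) ` ?F"
    then obtain i j i' j' where X: "X = {(i, j), (i', j')}" and in_F: "((i, j), (i', j')) \<in> ?F"
      by fastforce
    from in_F[unfolded F] have "max \<bar>int i - int i'\<bar> \<bar>int j - int j'\<bar> = 1" by auto
    with in_F[unfolded F] X show "X \<in> ?D" by blast
  qed
  \<comment> \<open>\<open>?F\<close> never contains both orders of a pair, since the second
    position comes strictly later row by row.\<close>
  moreover have "inj_on (\<lambda>(x, y). {x, y}) ?F"
  proof (rule inj_onI)
    fix u v assume uv: "u \<in> ?F" "v \<in> ?F" "(\<lambda>(x, y). {x, y}) u = (\<lambda>(x, y). {x, y}) v"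
    obtain i j i' j' where u: "u = ((i, j), (i', j'))" by (metis surj_pair)
    obtain k l k' l' where v: "v = ((k, l), (k', l'))" by (metis surj_pair)
    have "i' = i \<and> j' = Suc j \<or> i' = Suc i \<and> (j' = j \<or> j' = Suc j \<or> j = Suc j')"
      using uv(1) unfolding u F by blast
    moreover have "k' = k \<and> l' = Suc l \<or> k' = Suc k \<and> (l' = l \<or> l' = Suc l \<or> l = Suc l')"
      using uv(2) unfolding v F by blast
    moreover have "{(i, j), (i', j')} = {(k, l), (k', l')}" using uv(3) by (simp add: u v)
    ultimately show "u = v" unfolding u v doubleton_eq_iff by auto
  qed
  ultimately have "density A = card ?F"
    unfolding density_def by (simp add: card_image)
  also have "\<dots> = card ?F1 + card ?F2 + card ?F3 + card ?F4"
  proof -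
    \<comment> \<open>The four difference vectors are distinct.\<close>
    have "?F1 \<inter> ?F2 = {}" "(?F1 \<union> ?F2) \<inter> ?F3 = {}" "(?F1 \<union> ?F2 \<union> ?F3) \<inter> ?F4 = {}"
      by (auto simp: shift_pairs_def)
    then show ?thesis
      by (simp only: card_Un_disjoint finite_shift_pairs finite_Un simp_thms)
  qed
  also have "\<dots> = shift_sum A 0 0 0 1 (Suc m) n + shift_sum A 0 0 1 0 m (Suc n) +
    shift_sum A 0 0 1 1 m n + shift_sum A 0 1 1 0 m n"
    using assms by (simp add: card_shift_pairs)
  finally show ?thesis .
qed

lemma shift_sum_transpose:
  assumes "m + a \<le> dim_row A" "m + c \<le> dim_row A" "n + b \<le> dim_col A" "n + d \<le> dim_col A"
  shows "shift_sum (transpose_mat A) b a d c n m = shift_sum A a b c d m n"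
proof -
  have "shift_sum A a b c d m n = (\<Sum>j<n. \<Sum>i<m. A $$ (i + a, j + b) * A $$ (i + c, j + d))"
    unfolding shift_sum_def by (rule sum.swap)
  then show ?thesis
    unfolding shift_sum_def using assms by (auto intro!: sum.cong)
qed

text \<open>Needed because the second run of \<open>part\<close> measures the transpose of its
  candidate. Transposition exchanges the counts to the right and down and keeps down right; down
  left becomes up right, which gives the same unordered pairs.\<close>

lemma density_transpose:
  assumes "binary_mat A" "0 < dim_row A" "0 < dim_col A"
  shows "density (transpose_mat A) = density A"
proof -
  obtain m n where mn: "dim_row A = Suc m" "dim_col A = Suc n"
    using assms by (metis gr0_implies_Suc)
  \<comment> \<open>The anti-diagonal pairs read from their other ends.\<close>
  have "shift_sum A 1 0 0 1 m n = shift_sum A 0 1 1 0 m n"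
    unfolding shift_sum_def by (simp add: mult.commute)
  then show ?thesis
    using assms(1) mn
      shift_sum_transpose[of "Suc m" 0 A 0 n 0 1] shift_sum_transpose[of m 0 A 1 "Suc n" 0 0]
      shift_sum_transpose[of m 0 A 1 n 0 1] shift_sum_transpose[of m 1 A 0 n 0 1]
    by (simp add: density_shift_sum binary_mat_transpose)
qed

section \<open>Counting and copying over a whole matrix\<close>

lemma grid_count:
  assumes regs: "reg s rOne = 1" "reg s rA = a" "reg s rB = b" "reg s rM = m" "reg s rN = n"
      "reg s rRS = rs" "reg s rRS2 = rs" "reg s rCS = cs"
    and bounds: "a + m * rs + n * cs \<le> W" "b + m * rs + n * cs \<le> W" "reg s rCount + m * n \<le> W"
      "m \<le> W" "2 \<le> W"
    and bin: "\<And>i j. i < m \<Longrightarrow> j < n \<Longrightarrow> mem s (a + i * rs + j * cs) \<le> 1"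
      "\<And>i j. i < m \<Longrightarrow> j < n \<Longrightarrow> mem s (b + i * rs + j * cs) \<le> 1"
  shows "runs W (grid_loop count_body) s (\<lambda>t s'. t \<le> m * (10 * n + 8) + 2 \<and> mem s' = mem s \<and>
    reg s' rCount = reg s rCount +
      (\<Sum>i<m. \<Sum>j<n. mem s (a + i * rs + j * cs) * mem s (b + i * rs + j * cs)) \<and>
    agree {rI, rA, rB, rX, rY, rJ, rU, rV, rCount} s s')"
proof -
  let ?f = "\<lambda>i. \<Sum>j<n. mem s (a + i * rs + j * cs) * mem s (b + i * rs + j * cs)"
  let ?J = "\<lambda>k x \<mu>. x = reg s rCount + sum ?f {..<k} \<and> \<mu> = mem s"
  have le: "?f i \<le> n" if i: "i < m" for i
  proof -
    have "?f i \<le> of_nat (card {..<n}) * 1"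
      using mult_le_mono[OF bin(1)[OF i] bin(2)[OF i]] by (intro sum_bounded_above) simp
    then show ?thesis by simp
  qed
  have "runs W (grid_loop count_body) s (\<lambda>t s'. t \<le> m * (10 * n + 4 + 4) + 2 \<and>
    ?J m (reg s' rCount) (mem s') \<and> agree {rI, rA, rB, rX, rY, rJ, rU, rV, rCount} s s')"
  proof (rule grid_loop[OF regs(1,2,3,4,6,7)])
    fix k :: nat and s' :: ram
    assume k: "k < m" and J: "?J k (reg s' rCount) (mem s')"
      and ag: "agree {rI, rA, rB, rX, rY, rJ, rU, rV, rCount} s s'"
      and ab: "reg s' rA = a + k * rs" "reg s' rB = b + k * rs"
    have "sum ?f {..<k} \<le> of_nat (card {..<k}) * n" using k le by (intro sum_bounded_above) auto
    moreover have "Suc k * n \<le> m * n" "k * rs \<le> m * rs"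
      using mult_le_mono1[of "Suc k" m n] mult_le_mono1[of k m rs] k by auto
    ultimately have W: "reg s' rCount + n \<le> W" "a + k * rs + n * cs \<le> W" "b + k * rs + n * cs \<le> W"
      using J[THEN conjunct1] bounds unfolding mult_Suc card_lessThan of_nat_id by linarith+
    have "runs W (row_loop count_body) s' (\<lambda>t s''. t \<le> 10 * n + 4 \<and> mem s'' = mem s' \<and>
      reg s'' rCount = reg s' rCount +
        (\<Sum>j<n. mem s' (a + k * rs + j * cs) * mem s' (b + k * rs + j * cs)) \<and>
      agree {rX, rY, rJ, rU, rV, rCount} s' s'')"
      by (rule row_count) (use regs ab W bounds J bin[OF k] in \<open>simp_all add: agree_reg[OF ag]\<close>)
    then show "runs W (row_loop count_body) s' (\<lambda>t s''. t \<le> 10 * n + 4 \<and> ?J (Suc k) (reg s'' rCount) (mem s''))"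
      by (rule runs_weaken) (use J in simp)
  qed (use bounds in \<open>auto simp: count_body_def\<close>)
  then show ?thesis by (rule runs_weaken) (simp add: algebra_simps)
qed

text \<open>The target has row stride \<open>n\<close>, that is, the copy is compact, as the output
  convention requires. All sources lie below \<open>b\<close>, so no entry is overwritten before it
  is read.\<close>

lemma grid_copy:
  assumes regs: "reg s rOne = 1" "reg s rA = a" "reg s rB = b" "reg s rM = m" "reg s rN = n"
      "reg s rRS = rs" "reg s rRS2 = n" "reg s rCS = 1"
    and bounds: "a + m * rs + n \<le> W" "b + m * n \<le> W" "m \<le> W"
    and below: "\<And>i j. i < m \<Longrightarrow> j < n \<Longrightarrow> a + i * rs + j < b"
  shows "runs W (grid_loop copy_body) s (\<lambda>t s'. t \<le> m * (10 * n + 8) + 2 \<and>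
    (\<forall>i<m. \<forall>j<n. mem s' (b + i * n + j) = mem s (a + i * rs + j)) \<and>
    (\<forall>x. x < b \<or> b + m * n \<le> x \<longrightarrow> mem s' x = mem s x) \<and>
    agree {rI, rA, rB, rX, rY, rJ, rU, rV, rCount} s s')"
proof -
  let ?J = "\<lambda>k (y :: nat) \<mu>. (\<forall>i<k. \<forall>j<n. \<mu> (b + i * n + j) = mem s (a + i * rs + j)) \<and>
    (\<forall>x. x < b \<or> b + k * n \<le> x \<longrightarrow> \<mu> x = mem s x)"
  have "runs W (grid_loop copy_body) s (\<lambda>t s'. t \<le> m * (10 * n + 4 + 4) + 2 \<and>
    ?J m (reg s' rCount) (mem s') \<and> agree {rI, rA, rB, rX, rY, rJ, rU, rV, rCount} s s')"
  proof (rule grid_loop[OF regs(1,2,3,4,6,7)])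
    fix k :: nat and s' :: ram
    assume k: "k < m" and J: "?J k (reg s' rCount) (mem s')"
      and ag: "agree {rI, rA, rB, rX, rY, rJ, rU, rV, rCount} s s'"
      and ab: "reg s' rA = a + k * rs" "reg s' rB = b + k * n"
    have kn: "Suc k * n \<le> m * n" "k * rs \<le> m * rs"
      using mult_le_mono1[of "Suc k" m n] mult_le_mono1[of k m rs] k by auto
    have "n \<le> m * n" using k by simp
    then have W: "a + k * rs + n * 1 \<le> W" "b + k * n + n * 1 \<le> W" "n \<le> W"
      using kn bounds unfolding mult_1_right mult_Suc by linarith+
    have "runs W (row_loop copy_body) s' (\<lambda>t s''. t \<le> 10 * n + 4 \<and> reg s'' rCount = reg s' rCount \<and>
      (\<forall>j<n. mem s'' (b + k * n + j * 1) = mem s' (a + k * rs + j * 1)) \<and>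
      (\<forall>x. (\<forall>j<n. x \<noteq> b + k * n + j * 1) \<longrightarrow> mem s'' x = mem s' x) \<and>
      agree {rX, rY, rJ, rU, rV, rCount} s' s'')"
    proof (rule row_copy)
      show "i = j" if "j < n" "i < n" "a + k * rs + i * 1 = b + k * n + j * 1" for i j
        using below[OF k that(2)] that by simp
    qed (use regs ab W in \<open>simp_all add: agree_reg[OF ag]\<close>)
    then show "runs W (row_loop copy_body) s' (\<lambda>t s''. t \<le> 10 * n + 4 \<and> ?J (Suc k) (reg s'' rCount) (mem s''))"
    proof (rule runs_weaken, elim conjE)
      fix t :: nat and s'' :: ram
      assume t: "t \<le> 10 * n + 4"
        and new: "\<forall>j<n. mem s'' (b + k * n + j * 1) = mem s' (a + k * rs + j * 1)"
        and old: "\<forall>x. (\<forall>j<n. x \<noteq> b + k * n + j * 1) \<longrightarrow> mem s'' x = mem s' x"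
      have "mem s'' (b + i * n + j) = mem s (a + i * rs + j)" if "i < Suc k" "j < n" for i j
      proof (cases "i = k")
        case True
        then show ?thesis using new J below[OF k that(2)] that by simp
      next
        case False
        then have i: "i < k" using that by simp
        then have "Suc i * n \<le> k * n" by (intro mult_le_mono1) simp
        then have "mem s'' (b + i * n + j) = mem s' (b + i * n + j)"
          using old that by auto
        then show ?thesis using J i that by simp
      qed
      moreover have "mem s'' x = mem s x" if "x < b \<or> b + Suc k * n \<le> x" for x
      proof -
        have "mem s'' x = mem s' x" using old that by auto
        also have "\<dots> = mem s x" using J that by auto
        finally show ?thesis .
      qed
      ultimately show "t \<le> 10 * n + 4 \<and> ?J (Suc k) (reg s'' rCount) (mem s'')"
        using t by blast
    qed
  qed (use bounds in \<open>auto simp: copy_body_def\<close>)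
  then show ?thesis by (rule runs_weaken) (simp add: algebra_simps)
qed

section \<open>The density program\<close>

abbreviation (input) rM' :: nat where "rM' \<equiv> 8"
abbreviation (input) rN' :: nat where "rN' \<equiv> 9"
abbreviation (input) rSet2 :: nat where "rSet2 \<equiv> 29"
abbreviation (input) rM0 :: nat where "rM0 \<equiv> 30"
abbreviation (input) rN0 :: nat where "rN0 \<equiv> 31"

text \<open>Keeps the density counter, which accumulates four such sums, within the word
  size.\<close>

lemma shift_sum_le:
  assumes "binary_mat A" "m + a \<le> dim_row A" "m + c \<le> dim_row A" "n + b \<le> dim_col A" "n + d \<le> dim_col A"
  shows "shift_sum A a b c d m n \<le> m * n"
proof -
  have "(\<Sum>j<n. A $$ (i + a, j + b) * A $$ (i + c, j + d)) \<le> of_nat (card {..<n}) * 1" if "i < m" for i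
  proof (intro sum_bounded_above)
    fix j assume "j \<in> {..<n}"
    then have "A $$ (i + a, j + b) \<le> 1" "A $$ (i + c, j + d) \<le> 1"
      using assms that unfolding binary_mat_iff by auto
    then show "A $$ (i + a, j + b) * A $$ (i + c, j + d) \<le> 1"
      using mult_le_mono[of _ 1 _ 1] by simp
  qed
  then have "shift_sum A a b c d m n \<le> of_nat (card {..<m}) * n"
    unfolding shift_sum_def by (intro sum_bounded_above) simp
  then show ?thesis by simp
qed

text \<open>Each of the four counts sets \<open>rM\<close> and \<open>rN\<close> to the size of its
  window, so the true dimensions and their predecessors are saved beforehand.\<close>

definition density_init :: com where
  "density_init = Const rCount 0 ;; Move rRS2 rRS ;; Move rM0 rM ;; Move rN0 rN ;;
     Sub rM' rM rOne ;; Sub rN' rN rOne"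

definition count_right :: com where
  "count_right = Move rA rBase ;; Add rB rBase rCS ;; Move rM rM0 ;; Move rN rN' ;; grid_loop count_body"

definition count_down :: com where
  "count_down = Move rA rBase ;; Add rB rBase rRS ;; Move rM rM' ;; Move rN rN0 ;; grid_loop count_body"

definition count_diag :: com where
  "count_diag = Move rA rBase ;; Add rB rBase rRS ;; Add rB rB rCS ;; Move rM rM' ;; Move rN rN' ;;
     grid_loop count_body"

definition count_anti :: com where
  "count_anti = Add rA rBase rCS ;; Add rB rBase rRS ;; Move rM rM' ;; Move rN rN' ;; grid_loop count_body"

definition density_prog :: com where
  "density_prog = density_init ;; count_right ;; count_down ;; count_diag ;; count_anti ;;
     Move rM rM0 ;; Move rN rN0"

lemma writes_grid_count: "writes (grid_loop count_body) = {rI, rA, rB, rX, rY, rJ, rU, rV, rCount}"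
  by (auto simp: grid_loop_def row_loop_def count_body_def)

lemma writes_density_prog:
  "writes density_prog = {rM', rN', rM, rN, rI, rA, rB, rX, rY, rJ, rU, rV, rCount, rRS2, rM0, rN0}"
  unfolding density_prog_def density_init_def count_right_def count_down_def count_diag_def
    count_anti_def writes.simps writes_grid_count by auto

text \<open>Four counts of at most \<open>m * n\<close> each explain the word bound
  \<open>4 * (m * n)\<close>. Each count takes at most \<open>20 * (m * n)\<close> steps besides its
  setup; the constant number of other steps is covered by \<open>1 <= m * n\<close>.\<close>

lemma density_prog:
  fixes b rs cs :: nat and A :: "nat mat"
  defines "m \<equiv> dim_row A" and "n \<equiv> dim_col A"
  assumes regs: "reg s rOne = 1" "reg s rBase = b" "reg s rRS = rs" "reg s rCS = cs"
      "reg s rM = m" "reg s rN = n"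
    and bounds: "b + m * rs + n * cs \<le> W" "4 * (m * n) \<le> W" "2 \<le> W"
    and pos: "0 < m" "0 < n"
    and A: "laid_out (mem s) b rs cs A" "binary_mat A"
  shows "\<exists>t s'. exec W density_prog s t s' \<and> t \<le> 110 * (m * n) \<and> mem s' = mem s \<and>
    reg s' rCount = density A \<and> reg s' rM = m \<and> reg s' rN = n \<and> agree (writes density_prog) s s'"
proof -
  let ?X = "{rM', rN', rM, rN, rI, rA, rB, rX, rY, rJ, rU, rV, rCount, rRS2, rM0, rN0}"
  \<comment> \<open>\<open>k\<close> windows have been counted, with total \<open>x\<close>; the
    bound on \<open>x\<close> protects the following additions from overflow. Nothing is said about
    \<open>rA\<close>, \<open>rB\<close>, \<open>rM\<close> and \<open>rN\<close>, which every
    window sets anew.\<close>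
  define Inv where "Inv k x s' \<longleftrightarrow> mem s' = mem s \<and> reg s' rCount = x \<and> x \<le> k * (m * n) \<and>
    reg s' rM0 = m \<and> reg s' rN0 = n \<and> reg s' rM' = m - 1 \<and> reg s' rN' = n - 1 \<and> reg s' rRS2 = rs \<and>
    agree ?X s s'" for k x s'
  have Inv_regs: "reg s' rOne = 1" "reg s' rBase = b" "reg s' rRS = rs" "reg s' rCS = cs"
    if "Inv k x s'" for k x s'
    using that regs unfolding Inv_def by (simp_all add: agree_def)
  have grid: "runs W (grid_loop count_body) s1 (\<lambda>t s2. t \<le> 20 * (m * n) \<and>
      Inv (Suc k) (x + shift_sum A i j i' j' m' n') s2)"
    if s1: "Inv k x s1" and ab: "reg s1 rA = b + i * rs + j * cs" "reg s1 rB = b + i' * rs + j' * cs"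
      and mn: "reg s1 rM = m'" "reg s1 rN = n'"
      and k: "k < 4" and range: "m' + i \<le> m" "m' + i' \<le> m" "n' + j \<le> n" "n' + j' \<le> n"
    for s1 k x i j i' j' m' n'
  proof -
    \<comment> \<open>A shift and the size of its window together fit into the matrix, so the
      overshooting cursors obey the bound for the whole matrix.\<close>
    have "(m' + i) * rs \<le> m * rs" "(m' + i') * rs \<le> m * rs" "(n' + j) * cs \<le> n * cs"
      "(n' + j') * cs \<le> n * cs"
      using range by (simp_all only: mult_le_mono1)
    then have W: "b + i * rs + j * cs + m' * rs + n' * cs \<le> W" "b + i' * rs + j' * cs + m' * rs + n' * cs \<le> W"
      using bounds(1) by (simp_all add: algebra_simps)
    have "m' * n' \<le> m * n" using range by (intro mult_le_mono) auto
    moreover have "k * (m * n) + m * n \<le> 4 * (m * n)"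
      using mult_le_mono1[of "Suc k" 4 "m * n"] k unfolding mult_Suc by linarith
    moreover have "reg s1 rCount = x" "x \<le> k * (m * n)" using s1 unfolding Inv_def by auto
    ultimately have cnt: "reg s1 rCount + m' * n' \<le> W" "x + m' * n' \<le> Suc k * (m * n)"
      using bounds(2) unfolding mult_Suc by linarith+
    have "m \<le> m * n" using pos by simp
    then have mW: "m' \<le> W" using bounds(2) range by linarith
    have mem: "mem s1 (b + a * rs + c * cs + r * rs + d * cs) = A $$ (r + a, d + c)"
      if "r + a < m" "d + c < n" for a c r d
    proof -
      have "mem s1 (b + (r + a) * rs + (d + c) * cs) = A $$ (r + a, d + c)"
        using A(1) that s1 unfolding laid_out_def Inv_def m_def n_def by simp
      then show ?thesis by (simp add: algebra_simps)
    qed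
    have le: "A $$ (r, c) \<le> 1" if "r < m" "c < n" for r c
      using A(2) that unfolding binary_mat_iff m_def n_def by blast
    have sum: "(\<Sum>r<m'. \<Sum>c<n'. mem s1 (b + i * rs + j * cs + r * rs + c * cs) *
        mem s1 (b + i' * rs + j' * cs + r * rs + c * cs)) = shift_sum A i j i' j' m' n'"
      unfolding shift_sum_def using range by (intro sum.cong refl) (simp add: mem)
    have ssle: "shift_sum A i j i' j' m' n' \<le> m' * n'"
      using range A(2) unfolding m_def n_def by (intro shift_sum_le)
    have time: "m' * (10 * n' + 8) + 2 \<le> 20 * (m * n)"
    proof -
      have "m' * (10 * n' + 8) \<le> m * (10 * n + 8)" using range by (intro mult_le_mono) auto
      also have "\<dots> = 10 * (m * n) + 8 * m" by (simp add: algebra_simps)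
      finally have "m' * (10 * n' + 8) \<le> 10 * (m * n) + 8 * m" .
      moreover have "1 \<le> m * n" using pos by simp
      ultimately show ?thesis using \<open>m \<le> m * n\<close> by linarith
    qed
    have "runs W (grid_loop count_body) s1 (\<lambda>t s'. t \<le> m' * (10 * n' + 8) + 2 \<and> mem s' = mem s1 \<and>
      reg s' rCount = reg s1 rCount + shift_sum A i j i' j' m' n' \<and>
      agree {rI, rA, rB, rX, rY, rJ, rU, rV, rCount} s1 s')"
      unfolding sum[symmetric]
    proof (rule grid_count[OF Inv_regs(1)[OF s1] ab mn Inv_regs(3)[OF s1] _ Inv_regs(4)[OF s1] W cnt(1) mW bounds(3)])
      show "reg s1 rRS2 = rs" using s1 unfolding Inv_def by simp
    qed (use range in \<open>simp_all only: mem le\<close>)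
    then show ?thesis
    proof (rule runs_weaken, elim conjE)
      fix t :: nat and s2 :: ram
      assume t: "t \<le> m' * (10 * n' + 8) + 2" and m2: "mem s2 = mem s1"
        and c2: "reg s2 rCount = reg s1 rCount + shift_sum A i j i' j' m' n'"
        and ag: "agree {rI, rA, rB, rX, rY, rJ, rU, rV, rCount} s1 s2"
      have "agree ?X s s2" using s1 by (intro agree_step[OF ag]) (auto simp: Inv_def)
      then show "t \<le> 20 * (m * n) \<and> Inv (Suc k) (x + shift_sum A i j i' j' m' n') s2"
        using t time s1 m2 c2 cnt(2) ssle unfolding Inv_def by (simp add: agree_reg[OF ag])
    qed
  qed
  have W1: "b + rs \<le> W" "b + cs \<le> W" "b + rs + cs \<le> W"
  proof -
    have "1 * rs \<le> m * rs" "1 * cs \<le> n * cs" using pos by (intro mult_le_mono1; simp)+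
    then show "b + rs \<le> W" "b + cs \<le> W" "b + rs + cs \<le> W"
      using bounds(1) unfolding mult_1 by linarith+
  qed
  have "runs W density_init s (\<lambda>t s'. t = 6 \<and> Inv 0 0 s')"
    using regs bounds unfolding density_init_def Inv_def by (simp add: step_simps agree_def)
  then obtain s0 where e0: "exec W density_init s 6 s0" and s0: "Inv 0 0 s0"
    unfolding runs_def by blast
  have upd: "Inv k x s'" if "Inv k x s1" "mem s' = mem s1" "agree {rA, rB, rM, rN} s1 s'" for k x s1 s'
    using that(1,2) agree_step[OF that(3), of ?X s] unfolding Inv_def by (simp add: agree_reg[OF that(3)])
  have "runs W count_right s0 (\<lambda>t s'. t \<le> 20 * (m * n) + 4 \<and>
      Inv 1 (0 + shift_sum A 0 0 0 1 m (n - 1)) s')"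
    unfolding count_right_def step_simps
    by ((rule conjI, (use Inv_regs[OF s0] W1 in \<open>simp add: state_simps; fail\<close>))+,
        rule runs_weaken[OF grid[OF upd[OF s0], of _ 0 0 0 1 "m" "(n - 1)"]])
       (use s0 Inv_regs[OF s0] pos in \<open>simp_all add: state_simps Inv_def agree_def\<close>)
  then obtain t1 s1 where e1: "exec W count_right s0 t1 s1" and t1: "t1 \<le> 20 * (m * n) + 4"
      and s1: "Inv 1 (0 + shift_sum A 0 0 0 1 m (n - 1)) s1"
    unfolding runs_def by blast
  have "runs W count_down s1 (\<lambda>t s'. t \<le> 20 * (m * n) + 4 \<and>
      Inv 2 (0 + shift_sum A 0 0 0 1 m (n - 1) + shift_sum A 0 0 1 0 (m - 1) n) s')"
    unfolding count_down_def step_simps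
    by ((rule conjI, (use Inv_regs[OF s1] W1 in \<open>simp add: state_simps; fail\<close>))+,
        rule runs_weaken[OF grid[OF upd[OF s1], of _ 0 0 1 0 "(m - 1)" "n"]])
       (use s1 Inv_regs[OF s1] pos in \<open>simp_all add: state_simps Inv_def agree_def\<close>)
  then obtain t2 s2 where e2: "exec W count_down s1 t2 s2" and t2: "t2 \<le> 20 * (m * n) + 4"
      and s2: "Inv 2 (0 + shift_sum A 0 0 0 1 m (n - 1) + shift_sum A 0 0 1 0 (m - 1) n) s2"
    unfolding runs_def by blast
  have "runs W count_diag s2 (\<lambda>t s'. t \<le> 20 * (m * n) + 5 \<and>
      Inv 3 (0 + shift_sum A 0 0 0 1 m (n - 1) + shift_sum A 0 0 1 0 (m - 1) n + shift_sum A 0 0 1 1 (m - 1) (n - 1)) s')"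
    unfolding count_diag_def step_simps
    by ((rule conjI, (use Inv_regs[OF s2] W1 in \<open>simp add: state_simps; fail\<close>))+,
        rule runs_weaken[OF grid[OF upd[OF s2], of _ 0 0 1 1 "(m - 1)" "(n - 1)"]])
       (use s2 Inv_regs[OF s2] pos in \<open>simp_all add: state_simps Inv_def agree_def\<close>)
  then obtain t3 s3 where e3: "exec W count_diag s2 t3 s3" and t3: "t3 \<le> 20 * (m * n) + 5"
      and s3: "Inv 3 (0 + shift_sum A 0 0 0 1 m (n - 1) + shift_sum A 0 0 1 0 (m - 1) n + shift_sum A 0 0 1 1 (m - 1) (n - 1)) s3"
    unfolding runs_def by blast
  have "runs W count_anti s3 (\<lambda>t s'. t \<le> 20 * (m * n) + 4 \<and>
      Inv 4 (0 + shift_sum A 0 0 0 1 m (n - 1) + shift_sum A 0 0 1 0 (m - 1) n + shift_sum A 0 0 1 1 (m - 1) (n - 1) + shift_sum A 0 1 1 0 (m - 1) (n - 1)) s')"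
    unfolding count_anti_def step_simps
    by ((rule conjI, (use Inv_regs[OF s3] W1 in \<open>simp add: state_simps; fail\<close>))+,
        rule runs_weaken[OF grid[OF upd[OF s3], of _ 0 1 1 0 "(m - 1)" "(n - 1)"]])
       (use s3 Inv_regs[OF s3] pos in \<open>simp_all add: state_simps Inv_def agree_def\<close>)
  then obtain t4 s4 where e4: "exec W count_anti s3 t4 s4" and t4: "t4 \<le> 20 * (m * n) + 4"
      and s4: "Inv 4 (0 + shift_sum A 0 0 0 1 m (n - 1) + shift_sum A 0 0 1 0 (m - 1) n + shift_sum A 0 0 1 1 (m - 1) (n - 1) + shift_sum A 0 1 1 0 (m - 1) (n - 1)) s4"
    unfolding runs_def by blast
  have "runs W (Move rM rM0 ;; Move rN rN0) s4 (\<lambda>t s'. t = 2 \<and> mem s' = mem s4 \<and>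
      reg s' rM = m \<and> reg s' rN = n \<and> reg s' rCount = reg s4 rCount)"
    using s4 by (simp add: step_simps Inv_def)
  then obtain s5 where e5: "exec W (Move rM rM0 ;; Move rN rN0) s4 2 s5" and s5: "mem s5 = mem s4"
      "reg s5 rM = m" "reg s5 rN = n" "reg s5 rCount = reg s4 rCount"
    unfolding runs_def by blast
  have "exec W density_prog s (6 + (t1 + (t2 + (t3 + (t4 + 2))))) s5"
    unfolding density_prog_def
    by (rule exec.Seq[OF e0 exec.Seq[OF e1 exec.Seq[OF e2 exec.Seq[OF e3 exec.Seq[OF e4 e5]]]]])
  moreover have "6 + (t1 + (t2 + (t3 + (t4 + 2)))) \<le> 110 * (m * n)"
  proof -
    have "1 \<le> m * n" using pos by simp
    then show ?thesis using t1 t2 t3 t4 by linarith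
  qed
  moreover have "reg s5 rCount = density A"
    using s4 s5(4) pos density_shift_sum[OF A(2), of "m - 1" "n - 1"]
    unfolding Inv_def m_def n_def by simp
  moreover have "mem s5 = mem s" using s4 s5 unfolding Inv_def by simp
  ultimately show ?thesis
    using s5 exec_agree by blast
qed

section \<open>A part of the algorithm\<close>

definition turn :: com where
  "turn = Move rU rM ;; Move rM rN ;; Move rN rU ;; Move rU rRS ;; Move rRS rCS ;; Move rCS rU"

text \<open>The second \<open>turn\<close> restores the orientation, so the result is laid out as
  the contracted matrix and not as its transpose.\<close>

definition part :: com where
  "part = pass ;; turn ;; Move rSet rSet2 ;; pass ;; turn ;; density_prog"

lemma writes_part: "writes part = {rM', rN', rBase, rRS, rCS, rM, rN, rSet, rI, rK, rA, rB, rX, rY, rJ,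
    rU, rV, rCount, rRS2, rM0, rN0}"
  unfolding part_def turn_def writes.simps writes_pass writes_density_prog by auto

lemma turn:
  obtains s' where "exec W turn s 6 s'" "mem s' = mem s" "reg s' rM = reg s rN" "reg s' rN = reg s rM"
    "reg s' rRS = reg s rCS" "reg s' rCS = reg s rRS" "agree {rU, rM, rN, rRS, rCS} s s'"
proof -
  have "runs W turn s (\<lambda>t s'. t = 6 \<and> mem s' = mem s \<and> reg s' rM = reg s rN \<and> reg s' rN = reg s rM \<and>
    reg s' rRS = reg s rCS \<and> reg s' rCS = reg s rRS \<and> agree {rU, rM, rN, rRS, rCS} s s')"
    by (simp add: turn_def step_simps agree_def)
  then show thesis unfolding runs_def using that by blast
qed

text \<open>Both passes push the matrix towards the far corner of its region, so the base plus the
  extents in both directions is invariant. This equation locates the result for the density count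
  and for the final copy. The time is 48 + 48 + 110 per cell and 13 single steps, rounded
  up.\<close>

lemma part:
  fixes b rs cs sb sb2 lo hi :: nat and A :: "nat mat"
  defines "m \<equiv> dim_row A" and "n \<equiv> dim_col A"
  assumes regs: "reg s rOne = 1" "reg s rZero = 0" "reg s rBase = b" "reg s rRS = rs"
      "reg s rCS = cs" "reg s rM = m" "reg s rN = n" "reg s rSet = sb" "reg s rSet2 = sb2"
    and bounds: "b + m * rs + n * cs \<le> W" "sb + m \<le> W" "sb2 + n \<le> W" "4 * (m * n) \<le> W" "2 \<le> W"
    and pos: "0 < m" "0 < n" "0 < rs" "0 < cs"
    and inj: "\<And>r c r' c'. r < m \<Longrightarrow> c < n \<Longrightarrow> r' < m \<Longrightarrow> c' < n \<Longrightarrow>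
      b + r * rs + c * cs = b + r' * rs + c' * cs \<Longrightarrow> r = r' \<and> c = c'"
    and region: "\<And>r c. r < m \<Longrightarrow> c < n \<Longrightarrow> lo \<le> b + r * rs + c * cs \<and> b + r * rs + c * cs < hi"
      "hi \<le> sb" "sb + m \<le> sb2"
    and A: "laid_out (mem s) b rs cs A" "binary_mat A"
    and zero: "\<And>x. x < m - 1 \<Longrightarrow> mem s (sb + x) = 0" "\<And>x. x < n - 1 \<Longrightarrow> mem s (sb2 + x) = 0"
    and D: "LC_part A = (D, L, C)"
  obtains t s' where "exec W part s t s'" "t \<le> 220 * (m * n)"
    "0 < dim_row D" "dim_row D \<le> m" "0 < dim_col D" "dim_col D \<le> n" "binary_mat D"
    "L \<subseteq> {..<m - 1}" "C \<subseteq> {..<n - 1}"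
    "reg s' rM = dim_row D" "reg s' rN = dim_col D" "reg s' rCount = density D"
    "laid_out (mem s') (reg s' rBase) rs cs D"
    "reg s' rBase + dim_row D * rs + dim_col D * cs = b + m * rs + n * cs"
    "\<And>x. x < m - 1 \<Longrightarrow> mem s' (sb + x) = (if x \<in> L then 1 else 0)"
    "\<And>x. x < n - 1 \<Longrightarrow> mem s' (sb2 + x) = (if x \<in> C then 1 else 0)"
    "\<And>x. \<not> (lo \<le> x \<and> x < hi) \<Longrightarrow> \<not> (sb \<le> x \<and> x < sb + (m - 1)) \<Longrightarrow>
      \<not> (sb2 \<le> x \<and> x < sb2 + (n - 1)) \<Longrightarrow> mem s' x = mem s x"
    "agree (writes part) s s'"
proof -
  obtain B where B: "line_pass A = (B, L)"
    using D by (auto simp: LC_part_transpose split: prod.splits)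
  obtain E where E: "line_pass (transpose_mat B) = (E, C)" and DE: "D = transpose_mat E"
    using D by (auto simp: LC_part_transpose B split: prod.splits)
  have W: "m \<le> W" "n \<le> W" using bounds by auto

  obtain t1 s1 where e1: "exec W pass s t1 s1" and t1: "t1 \<le> 48 * (m * n)"
    and B_dims: "0 < dim_row B" "dim_row B \<le> m" "dim_col B = n" "binary_mat B" "L \<subseteq> {..<m - 1}"
    and s1: "reg s1 rM = dim_row B" "reg s1 rBase = b + (m - dim_row B) * rs"
      "laid_out (mem s1) (reg s1 rBase) rs cs B"
      "\<forall>x<m - 1. mem s1 (sb + x) = (if x \<in> L then 1 else 0)"
      "\<forall>x. \<not> (lo \<le> x \<and> x < hi) \<longrightarrow> \<not> (sb \<le> x \<and> x < sb + (m - 1)) \<longrightarrow> mem s1 x = mem s x"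
      "agree (writes pass) s s1"
    using pass[of s b rs cs A sb W lo hi B L, folded m_def n_def, OF regs(1-8) bounds(1,2) W bounds(5)
        pos(1,2,4) inj region(1,2) A zero(1) B] unfolding runs_def by blast
  have regs1: "reg s1 rOne = 1" "reg s1 rZero = 0" "reg s1 rRS = rs" "reg s1 rCS = cs" "reg s1 rN = n"
      "reg s1 rSet2 = sb2"
    using regs by (simp_all add: agree_reg[OF s1(6)[unfolded writes_pass]])

  define b1 where "b1 = b + (m - dim_row B) * rs"
  have b1: "b1 + dim_row B * rs = b + m * rs"
  proof -
    have "(m - dim_row B) * rs + dim_row B * rs = m * rs"
      using B_dims(2) by (metis add_mult_distrib le_add_diff_inverse2)
    then show ?thesis by (simp add: b1_def)
  qed
  \<comment> \<open>Cells of \<open>B\<close> occupy cells of \<open>A\<close> whose line numbers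
    are larger by the number of contractions; injectivity and the enclosing region thus carry over
    to the second pass.\<close>
  have shift: "b1 + i * rs + j * cs = b + (m - dim_row B + i) * rs + j * cs" for i j
    by (simp add: b1_def algebra_simps)

  obtain s2 where e2: "exec W turn s1 6 s2" and s2: "mem s2 = mem s1" "reg s2 rM = reg s1 rN"
      "reg s2 rN = reg s1 rM" "reg s2 rRS = reg s1 rCS" "reg s2 rCS = reg s1 rRS"
      "agree {rU, rM, rN, rRS, rCS} s1 s2"
    by (rule turn)
  define s3 where "s3 = set_reg rSet (reg s2 rSet2) s2"
  have e3: "exec W (Move rSet rSet2) s2 1 s3" unfolding s3_def by (rule exec.Move)
  have regs3: "reg s3 rOne = 1" "reg s3 rZero = 0" "reg s3 rBase = b1" "reg s3 rRS = cs"
      "reg s3 rCS = rs" "reg s3 rM = dim_row (transpose_mat B)" "reg s3 rN = dim_col (transpose_mat B)"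
      "reg s3 rSet = sb2" and m3: "mem s3 = mem s1"
    using regs1 s1 s2(1-5) B_dims by (simp_all add: s3_def state_simps agree_reg[OF s2(6)] b1_def)

  have dimB: "dim_row (transpose_mat B) = n" "dim_col (transpose_mat B) = dim_row B"
    using B_dims by simp_all
  obtain t4 s4 where e4: "exec W pass s3 t4 s4" and t4: "t4 \<le> 48 * (n * dim_row B)"
    and E_dims: "0 < dim_row E" "dim_row E \<le> n" "dim_col E = dim_row B" "binary_mat E" "C \<subseteq> {..<n - 1}"
    and s4: "reg s4 rM = dim_row E" "reg s4 rBase = b1 + (n - dim_row E) * cs"
      "laid_out (mem s4) (reg s4 rBase) cs rs E"
      "\<forall>x<n - 1. mem s4 (sb2 + x) = (if x \<in> C then 1 else 0)"
      "\<forall>x. \<not> (lo \<le> x \<and> x < hi) \<longrightarrow> \<not> (sb2 \<le> x \<and> x < sb2 + (n - 1)) \<longrightarrow> mem s4 x = mem s3 x"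
      "agree (writes pass) s3 s4"
  proof -
    have "runs W pass s3 (\<lambda>t s'. t \<le> 48 * (n * dim_row B) \<and> 0 < dim_row E \<and> dim_row E \<le> n \<and>
      dim_col E = dim_row B \<and> binary_mat E \<and> C \<subseteq> {..<n - 1} \<and> reg s' rM = dim_row E \<and>
      reg s' rBase = b1 + (n - dim_row E) * cs \<and> laid_out (mem s') (reg s' rBase) cs rs E \<and>
      (\<forall>x<n - 1. mem s' (sb2 + x) = (if x \<in> C then 1 else 0)) \<and>
      (\<forall>x. \<not> (lo \<le> x \<and> x < hi) \<longrightarrow> \<not> (sb2 \<le> x \<and> x < sb2 + (n - 1)) \<longrightarrow> mem s' x = mem s3 x) \<and>
      agree (writes pass) s3 s')"
    proof (rule pass[where A = "transpose_mat B" and lo = lo and hi = hi and rs = cs and cs = rs and b = b1, unfolded dimB,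
          OF regs3[unfolded dimB] _ bounds(3) W(2) _ bounds(5) pos(2) B_dims(1) pos(3)])
      show "b1 + n * cs + dim_row B * rs \<le> W" using b1 bounds(1) by linarith
      show "dim_row B \<le> W" using B_dims W by simp
      show "r = r' \<and> c = c'" if "r < n" "c < dim_row B" "r' < n" "c' < dim_row B"
        "b1 + r * cs + c * rs = b1 + r' * cs + c' * rs" for r c r' c'
      proof -
        have "b1 + c * rs + r * cs = b1 + c' * rs + r' * cs" using that(5) by simp
        then have "m - dim_row B + c = m - dim_row B + c' \<and> r = r'"
          unfolding shift by (intro inj) (use that B_dims in auto)
        then show ?thesis by simp
      qed
      show "lo \<le> b1 + r * cs + c * rs \<and> b1 + r * cs + c * rs < hi" if "r < n" "c < dim_row B" for r c
      proof -
        have "lo \<le> b1 + c * rs + r * cs \<and> b1 + c * rs + r * cs < hi"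
          unfolding shift by (intro region) (use that B_dims in auto)
        then show ?thesis by (simp add: add.assoc add.commute[of "r * cs"])
      qed
      show "hi \<le> sb2" using region by simp
      show "laid_out (mem s3) b1 cs rs (transpose_mat B)"
        using s1(2,3) by (simp add: laid_out_transpose m3 b1_def)
      show "binary_mat (transpose_mat B)" using B_dims by (simp add: binary_mat_transpose)
      show "mem s3 (sb2 + x) = 0" if "x < n - 1" for x
        using s1(5) zero(2)[OF that] region(2,3) m3 by simp
      show "line_pass (transpose_mat B) = (E, C)" by (rule E)
    qed
    then show thesis unfolding runs_def using that by blast
  qed
  have regs4: "reg s4 rOne = 1" "reg s4 rRS = cs" "reg s4 rCS = rs" "reg s4 rN = dim_row B"
    using regs3 dimB by (simp_all add: agree_reg[OF s4(6)[unfolded writes_pass]])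

  obtain s5 where e5: "exec W turn s4 6 s5" and s5: "mem s5 = mem s4" "reg s5 rM = reg s4 rN"
      "reg s5 rN = reg s4 rM" "reg s5 rRS = reg s4 rCS" "reg s5 rCS = reg s4 rRS"
      "agree {rU, rM, rN, rRS, rCS} s4 s5"
    by (rule turn)
  have dimD: "dim_row D = dim_row B" "dim_col D = dim_row E" using E_dims by (simp_all add: DE)
  have base: "reg s4 rBase + dim_row D * rs + dim_col D * cs = b + m * rs + n * cs"
  proof -
    have "(n - dim_row E) * cs + dim_row E * cs = n * cs"
      using E_dims(2) by (metis add_mult_distrib le_add_diff_inverse2)
    then show ?thesis using b1 by (simp add: s4(2) dimD)
  qed
  have mn: "dim_row B * dim_row E \<le> m * n" "n * dim_row B \<le> m * n"
    using mult_le_mono[OF B_dims(2) E_dims(2)] mult_le_mono2[OF B_dims(2), of n] by (simp_all add: mult.commute)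
  have binD: "binary_mat D" using E_dims by (simp add: DE binary_mat_transpose)
  have layD: "laid_out (mem s5) (reg s4 rBase) rs cs D"
    using s4(3) s5(1) by (simp add: DE laid_out_transpose)
  obtain t6 s6 where e6: "exec W density_prog s5 t6 s6" and t6: "t6 \<le> 110 * (dim_row B * dim_row E)"
    and s6: "mem s6 = mem s5" "reg s6 rCount = density D" "reg s6 rM = dim_row D" "reg s6 rN = dim_col D"
      "agree (writes density_prog) s5 s6"
  proof -
    have "\<exists>t s'. exec W density_prog s5 t s' \<and> t \<le> 110 * (dim_row D * dim_col D) \<and> mem s' = mem s5 \<and>
      reg s' rCount = density D \<and> reg s' rM = dim_row D \<and> reg s' rN = dim_col D \<and>
      agree (writes density_prog) s5 s'"
    proof (rule density_prog[OF _ _ _ _ _ _ _ _ bounds(5) _ _ layD binD])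
      show "reg s4 rBase + dim_row D * rs + dim_col D * cs \<le> W" using base bounds by simp
      show "4 * (dim_row D * dim_col D) \<le> W" using mn bounds dimD by simp
    qed (use regs4 s5(1-5) s4(1) dimD B_dims E_dims in \<open>simp_all add: agree_reg[OF s5(6)]\<close>)
    then show thesis using that dimD by auto
  qed
  have base6: "reg s6 rBase = reg s4 rBase"
    by (simp add: agree_reg[OF s6(5)[unfolded writes_density_prog]] agree_reg[OF s5(6)])
  \<comment> \<open>After \<open>s1\<close> only the second pass writes to memory, so the set of
    contracted lines survives.\<close>
  have frame: "mem s6 x = mem s1 x" if "\<not> (lo \<le> x \<and> x < hi)" "\<not> (sb2 \<le> x \<and> x < sb2 + (n - 1))" for x
    using s4(5) that s5(1) s6(1) m3 by simp

  have e: "exec W part s (t1 + (6 + (1 + (t4 + (6 + t6))))) s6"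
    unfolding part_def
    by (rule exec.Seq[OF e1 exec.Seq[OF e2 exec.Seq[OF e3 exec.Seq[OF e4 exec.Seq[OF e5 e6]]]]])
  show thesis
  proof (rule that[OF e])
    have "1 \<le> m * n" using pos by simp
    then show "t1 + (6 + (1 + (t4 + (6 + t6)))) \<le> 220 * (m * n)" using t1 t4 t6 mn by linarith
    show "laid_out (mem s6) (reg s6 rBase) rs cs D" using layD s6(1) base6 by simp
    show "reg s6 rBase + dim_row D * rs + dim_col D * cs = b + m * rs + n * cs"
      using base base6 by simp
    show "mem s6 (sb + x) = (if x \<in> L then 1 else 0)" if "x < m - 1" for x
      using frame[of "sb + x"] s1(4) that region by simp
    show "mem s6 (sb2 + x) = (if x \<in> C then 1 else 0)" if "x < n - 1" for x
      using s4(4) that s5(1) s6(1) by simp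
    show "mem s6 x = mem s x" if "\<not> (lo \<le> x \<and> x < hi)" "\<not> (sb \<le> x \<and> x < sb + (m - 1))"
      "\<not> (sb2 \<le> x \<and> x < sb2 + (n - 1))" for x
      using frame[OF that(1,3)] s1(5) that by simp
  qed (use B_dims E_dims s6 binD dimD exec_agree[OF e] in auto)
qed

section \<open>The LCL program\<close>

abbreviation (input) rP :: nat where "rP \<equiv> 0"
abbreviation (input) rQ :: nat where "rQ \<equiv> 1"
abbreviation (input) rOut :: nat where "rOut \<equiv> 2"
abbreviation (input) rLines :: nat where "rLines \<equiv> 3"
abbreviation (input) rCols :: nat where "rCols \<equiv> 4"
abbreviation (input) rBase1 :: nat where "rBase1 \<equiv> 32"
abbreviation (input) rM1 :: nat where "rM1 \<equiv> 33"
abbreviation (input) rN1 :: nat where "rN1 \<equiv> 34"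
abbreviation (input) rDensity1 :: nat where "rDensity1 \<equiv> 35"

definition init :: com where
  "init = Const rOne 1 ;; Const rZero 0 ;; Const rSize 0 ;; Const rJ 0 ;;
     WhileLess rJ rP (Add rSize rSize rQ ;; Add rJ rJ rOne)"

definition copy_input :: com where
  "copy_input = Move rA rZero ;; Move rB rSize ;; Move rM rP ;; Move rN rQ ;; Move rRS rQ ;;
     Move rRS2 rQ ;; Move rCS rOne ;; grid_loop copy_body"

text \<open>
  With \<open>N = p * q\<close>, the first part works on the input at address 0, the second one on the transpose of
  its copy at address \<open>N\<close>. The sets of the first part are at \<open>2 * N\<close> and \<open>3 * N\<close>, those of the second
  part at \<open>4 * N\<close> and \<open>5 * N\<close>, and the matrix that is returned is copied to \<open>6 * N\<close>.
\<close>

definition setup_LC :: com where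
  "setup_LC = Move rBase rZero ;; Move rM rP ;; Move rN rQ ;; Move rRS rQ ;; Move rCS rOne ;;
     Add rSet rSize rSize ;; Add rSet2 rSet rSize"

text \<open>\<open>part\<close> overwrites \<open>rSet\<close> by \<open>rSet2\<close>, so the
  address of the first set is recovered by subtracting the size. Strides 1 and \<open>q\<close>
  present the copy at the address \<open>rSize\<close> as its transpose.\<close>

definition setup_CL :: com where
  "setup_CL = Move rBase1 rBase ;; Move rM1 rM ;; Move rN1 rN ;; Move rDensity1 rCount ;;
     Sub rLines rSet2 rSize ;; Move rCols rSet2 ;;
     Move rBase rSize ;; Move rM rQ ;; Move rN rP ;; Move rRS rOne ;; Move rCS rQ ;;
     Add rSet rSet2 rSize ;; Add rSet2 rSet rSize"

text \<open>In the second part the first set consists of columns and the second of lines, since it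
  ran on the transpose. Exchanging the dimensions undoes the transposition; the entries need no
  rearrangement because they are addressed with row stride \<open>q\<close> in both cases.\<close>

definition select_part :: com where
  "select_part = IfLess rDensity1 rCount
     (Sub rCols rSet2 rSize ;; Move rLines rSet2 ;; Move rA rBase ;; Move rU rM ;; Move rM rN ;; Move rN rU)
     (Move rA rBase1 ;; Move rM rM1 ;; Move rN rN1)"

text \<open>The order matters: \<open>rQ\<close> still supplies the source stride before it receives
  the number of output columns. Copying is necessary as the result still has row stride
  \<open>q\<close>.\<close>

definition finish :: com where
  "finish = Add rB rSet2 rSize ;; Add rOut rSet2 rSize ;; Move rP rM ;; Move rRS rQ ;; Move rQ rN ;;
     Move rRS2 rN ;; Move rCS rOne ;; grid_loop copy_body"

definition LCL :: com where
  "LCL = init ;; copy_input ;; setup_LC ;; part ;; setup_CL ;; part ;; select_part ;; finish"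

text \<open>Without a multiplication instruction, \<open>p * q\<close> is accumulated in
  \<open>p\<close> additions.\<close>

lemma init:
  assumes "reg s rP = p" "reg s rQ = q" "p * q \<le> W" "0 < p" "0 < q"
  obtains t s' where "exec W init s t s'" "t \<le> 8 * (p * q)" "mem s' = mem s" "reg s' rOne = 1"
    "reg s' rZero = 0" "reg s' rSize = p * q" "reg s' rP = p" "reg s' rQ = q"
proof -
  let ?c = "Add rSize rSize rQ ;; Add rJ rJ rOne"
  define s1 where "s1 = set_reg rJ 0 (set_reg rSize 0 (set_reg rZero 0 (set_reg rOne 1 s)))"
  have s1: "reg s1 = (reg s)(rOne := 1, rZero := 0, rSize := 0, rJ := 0)" "mem s1 = mem s"
    by (simp_all add: s1_def state_simps)
  have pq: "p \<le> p * q" "1 \<le> p * q" using assms(4,5) by simp_all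
  have "runs W (WhileLess rJ rP ?c) s1 (\<lambda>t s'. t \<le> p * (2 + 1) + 1 \<and>
    (reg s' rSize = p * q \<and> reg s' rJ = p \<and> mem s' = mem s) \<and> agree (writes ?c) s1 s')"
  proof (rule runs_for[where I = "\<lambda>k s'. reg s' rSize = k * q \<and> reg s' rJ = k \<and> mem s' = mem s"])
    fix k :: nat and s' :: ram
    assume k: "k < p" and I: "reg s' rSize = k * q \<and> reg s' rJ = k \<and> mem s' = mem s"
      and ag: "agree (writes ?c) s1 s'"
    have "Suc k * q \<le> p * q" using k by (intro mult_le_mono1) simp
    then have "k * q + q \<le> W" "k + 1 \<le> W" using assms(3) pq k unfolding mult_Suc by linarith+
    then show "reg s' rJ < reg s' rP \<and> runs W ?c s' (\<lambda>t s''. t \<le> 2 \<and>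
        reg s'' rSize = Suc k * q \<and> reg s'' rJ = Suc k \<and> mem s'' = mem s)"
      using k I assms(1,2) by (simp add: step_simps agree_reg[OF ag] s1)
  next
    fix s' :: ram assume "reg s' rSize = p * q \<and> reg s' rJ = p \<and> mem s' = mem s"
      and ag: "agree (writes ?c) s1 s'"
    then show "\<not> reg s' rJ < reg s' rP" using assms(1) by (simp add: agree_reg[OF ag] s1)
  qed (simp add: s1)
  then obtain t s' where e: "exec W (WhileLess rJ rP ?c) s1 t s'" and t: "t \<le> p * (2 + 1) + 1"
    and s': "reg s' rSize = p * q" "mem s' = mem s" "agree (writes ?c) s1 s'"
    unfolding runs_def by blast
  have "1 \<le> W" using pq(2) assms(3) by (rule le_trans)
  then have "exec W init s (1 + (1 + (1 + (1 + t)))) s'"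
    unfolding init_def using e unfolding s1_def
    by (intro exec.Seq[OF exec.Const] exec.Seq[OF exec.Const] exec.Seq[OF exec.Const] exec.Seq[OF exec.Const]) simp_all
  moreover have "t \<le> 3 * p + 1" using t by simp
  with pq have "1 + (1 + (1 + (1 + t))) \<le> 8 * (p * q)" by linarith
  ultimately show thesis
    by (rule that) (use s' assms(1,2) in \<open>simp_all add: agree_reg[OF s'(3)] s1\<close>)
qed

lemma copy_input:
  assumes regs: "reg s rOne = 1" "reg s rZero = 0" "reg s rSize = p * q" "reg s rP = p" "reg s rQ = q"
    and W: "2 * (p * q) \<le> W" and pos: "0 < p" "0 < q"
  obtains t s' where "exec W copy_input s t s'" "t \<le> 30 * (p * q)"
    "\<And>i j. i < p \<Longrightarrow> j < q \<Longrightarrow> mem s' (p * q + i * q + j) = mem s (i * q + j)"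
    "\<And>x. x < p * q \<or> 2 * (p * q) \<le> x \<Longrightarrow> mem s' x = mem s x"
    "reg s' rOne = 1" "reg s' rZero = 0" "reg s' rSize = p * q" "reg s' rP = p" "reg s' rQ = q"
proof -
  have pq: "p \<le> p * q" "q \<le> p * q" "1 \<le> p * q" using pos by simp_all
  have W': "p * q + q \<le> W" "p \<le> W" using pq W by linarith+
  define s1 where "s1 = set_reg rCS 1 (set_reg rRS2 q (set_reg rRS q (set_reg rN q (set_reg rM p
    (set_reg rB (p * q) (set_reg rA 0 s))))))"
  have s1: "reg s1 = (reg s)(rA := 0, rB := p * q, rM := p, rN := q, rRS := q, rRS2 := q, rCS := 1)"
    "mem s1 = mem s"
    by (simp_all add: s1_def state_simps)
  have "runs W (grid_loop copy_body) s1 (\<lambda>t s'. t \<le> p * (10 * q + 8) + 2 \<and>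
    (\<forall>i<p. \<forall>j<q. mem s' (p * q + i * q + j) = mem s1 (0 + i * q + j)) \<and>
    (\<forall>x. x < p * q \<or> p * q + p * q \<le> x \<longrightarrow> mem s' x = mem s1 x) \<and>
    agree {rI, rA, rB, rX, rY, rJ, rU, rV, rCount} s1 s')"
  proof (rule grid_copy)
    show "0 + i * q + j < p * q" if "i < p" "j < q" for i j
    proof -
      have "Suc i * q \<le> p * q" using that by (intro mult_le_mono1) simp
      then show ?thesis using that unfolding mult_Suc by linarith
    qed
  qed (use regs W W' in \<open>simp_all add: s1\<close>)
  then have "runs W copy_input s (\<lambda>t s'. t \<le> p * (10 * q + 8) + 9 \<and>
    (\<forall>i<p. \<forall>j<q. mem s' (p * q + i * q + j) = mem s1 (0 + i * q + j)) \<and>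
    (\<forall>x. x < p * q \<or> p * q + p * q \<le> x \<longrightarrow> mem s' x = mem s1 x) \<and>
    agree {rI, rA, rB, rX, rY, rJ, rU, rV, rCount} s1 s')"
    \<comment> \<open>\<open>rQ\<close> is register 1, which the simplifier turns into
      \<open>Suc 0\<close>; its value is therefore supplied in that form too.\<close>
    unfolding copy_input_def runs_Seq runs_simps(3)
    by (simp add: regs regs(5)[unfolded One_nat_def] state_simps s1_def)
  then obtain t s' where "exec W copy_input s t s'" and t: "t \<le> p * (10 * q + 8) + 9"
    and s': "\<forall>i<p. \<forall>j<q. mem s' (p * q + i * q + j) = mem s1 (0 + i * q + j)"
      "\<forall>x. x < p * q \<or> p * q + p * q \<le> x \<longrightarrow> mem s' x = mem s1 x"
      "agree {rI, rA, rB, rX, rY, rJ, rU, rV, rCount} s1 s'"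
    unfolding runs_def by blast
  moreover have "p * (10 * q + 8) + 9 = 10 * (p * q) + 8 * p + 9"
    by (simp add: algebra_simps)
  with t pq have "t \<le> 30 * (p * q)" by linarith
  ultimately show thesis
    by (intro that[of t s']) (use regs in \<open>auto simp: agree_reg[OF s'(3)] s1 mult_2\<close>)
qed

text \<open>All sources end before \<open>6 * (p * q)\<close>: the matrix by the bound on
  \<open>a\<close> and its extents, and each set because it starts at \<open>5 * (p * q)\<close> at
  the latest and has fewer than \<open>p * q\<close> marks. Hence the output destroys none of
  them.\<close>

lemma finish:
  assumes regs: "reg s rOne = 1" "reg s rSize = p * q" "reg s rSet2 = 5 * (p * q)" "reg s rQ = q"
      "reg s rA = a" "reg s rM = dim_row D" "reg s rN = dim_col D"
    and W: "10 * (p * q) \<le> W"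
    and dims: "0 < p" "0 < q" "dim_row D \<le> p" "dim_col D \<le> q" "a + dim_row D * q + dim_col D \<le> 2 * (p * q) + q"
    and D: "laid_out (mem s) a q 1 D"
    and L: "L \<subseteq> {..<p - 1}" "\<And>x. x < p - 1 \<Longrightarrow> mem s (reg s rLines + x) = (if x \<in> L then 1 else 0)"
      "reg s rLines \<le> 5 * (p * q)"
    and C: "C \<subseteq> {..<q - 1}" "\<And>x. x < q - 1 \<Longrightarrow> mem s (reg s rCols + x) = (if x \<in> C then 1 else 0)"
      "reg s rCols \<le> 5 * (p * q)"
  obtains t s' where "exec W finish s t s'" "t \<le> 30 * (p * q)" "outputs p q s' (D, L, C)"
proof -
  define m n where "m = dim_row D" and "n = dim_col D"
  have pq: "p \<le> p * q" "q \<le> p * q" "1 \<le> p * q" using dims by simp_all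
  have mn: "m \<le> p" "n \<le> q" "m * n \<le> p * q" "m * q \<le> p * q"
    using dims by (simp_all only: m_def n_def mult_le_mono order_refl)
  define s1 where "s1 = set_reg rCS 1 (set_reg rRS2 n (set_reg rQ n (set_reg rRS q (set_reg rP m
    (set_reg rOut (6 * (p * q)) (set_reg rB (6 * (p * q)) s))))))"
  have s1: "reg s1 = (reg s)(rB := 6 * (p * q), rOut := 6 * (p * q), rP := m, rRS := q, rQ := n,
      rRS2 := n, rCS := 1)" "mem s1 = mem s"
    by (simp_all add: s1_def state_simps)
  have "runs W (grid_loop copy_body) s1 (\<lambda>t s'. t \<le> m * (10 * n + 8) + 2 \<and>
    (\<forall>i<m. \<forall>j<n. mem s' (6 * (p * q) + i * n + j) = mem s1 (a + i * q + j)) \<and>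
    (\<forall>x. x < 6 * (p * q) \<or> 6 * (p * q) + m * n \<le> x \<longrightarrow> mem s' x = mem s1 x) \<and>
    agree {rI, rA, rB, rX, rY, rJ, rU, rV, rCount} s1 s')"
  proof (rule grid_copy)
    have bnd: "a + m * q + n \<le> 2 * (p * q) + q" using dims by (simp add: m_def n_def)
    show "a + m * q + n \<le> W" using bnd pq W by linarith
    show "6 * (p * q) + m * n \<le> W" using mn W by linarith
    show "m \<le> W" using mn pq W by linarith
    show "a + i * q + j < 6 * (p * q)" if "i < m" "j < n" for i j
    proof -
      have "i * q \<le> m * q" using that by (intro mult_le_mono1) simp
      then show ?thesis using that bnd pq by linarith
    qed
  qed (use regs in \<open>simp_all add: s1 m_def n_def\<close>)
  then have "runs W finish s (\<lambda>t s'. t \<le> m * (10 * n + 8) + 9 \<and>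
    (\<forall>i<m. \<forall>j<n. mem s' (6 * (p * q) + i * n + j) = mem s1 (a + i * q + j)) \<and>
    (\<forall>x. x < 6 * (p * q) \<or> 6 * (p * q) + m * n \<le> x \<longrightarrow> mem s' x = mem s1 x) \<and>
    agree {rI, rA, rB, rX, rY, rJ, rU, rV, rCount} s1 s')"
    using W unfolding finish_def runs_Seq runs_simps(3,4)
    by (simp add: regs regs(4)[unfolded One_nat_def] state_simps s1_def m_def n_def)
  then obtain t s' where e: "exec W finish s t s'" and t: "t \<le> m * (10 * n + 8) + 9"
    and s': "\<forall>i<m. \<forall>j<n. mem s' (6 * (p * q) + i * n + j) = mem s1 (a + i * q + j)"
      "\<forall>x. x < 6 * (p * q) \<or> 6 * (p * q) + m * n \<le> x \<longrightarrow> mem s' x = mem s1 x"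
      "agree {rI, rA, rB, rX, rY, rJ, rU, rV, rCount} s1 s'"
    unfolding runs_def by blast
  have "m * (10 * n + 8) + 9 = 10 * (m * n) + 8 * m + 9" by (simp add: algebra_simps)
  then have "t \<le> 30 * (p * q)" using t mn pq by linarith
  moreover have "outputs p q s' (D, L, C)"
  proof -
    have regs': "reg s' rP = m" "reg s' rQ = n" "reg s' rOut = 6 * (p * q)" "reg s' rLines = reg s rLines"
      "reg s' rCols = reg s rCols"
      by (simp_all add: agree_reg[OF s'(3)] s1)
    have "holds_matrix s' (6 * (p * q)) D"
      using s'(1) D unfolding holds_matrix_def laid_out_def m_def n_def by (simp add: s1)
    moreover have "holds_set s' (reg s rLines) (p - 1) L"
      unfolding holds_set_def
    proof (intro conjI allI impI)
      fix x assume x: "x < p - 1"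
      then have "reg s rLines + x < 6 * (p * q)" using L(3) pq by linarith
      then show "mem s' (reg s rLines + x) = (if x \<in> L then 1 else 0)"
        using s'(2) L(2)[OF x] s1 by simp
    qed (rule L(1))
    moreover have "holds_set s' (reg s rCols) (q - 1) C"
      unfolding holds_set_def
    proof (intro conjI allI impI)
      fix x assume x: "x < q - 1"
      then have "reg s rCols + x < 6 * (p * q)" using C(3) pq by linarith
      then show "mem s' (reg s rCols + x) = (if x \<in> C then 1 else 0)"
        using s'(2) C(2)[OF x] s1 by simp
    qed (rule C(1))
    ultimately show ?thesis
      unfolding outputs_def by (simp add: regs' regs'(2)[unfolded One_nat_def] m_def n_def)
  qed
  ultimately show thesis using e that by blast
qed

lemma part_keeps:
  assumes "agree (writes part) s s'" "r \<in> {rP, rQ, rLines, rCols, rOne, rSize, rZero, rSet2, rBase1, rM1, rN1, rDensity1}"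
  shows "reg s' r = reg s r"
  using assms unfolding agree_def writes_part by auto

section \<open>Correctness and running time of the whole program\<close>

lemma LCL_correct:
  assumes p: "0 < p" and q: "0 < q" and M: "M \<in> carrier_mat p q" "binary_mat M"
  shows "\<exists>t s R. exec (10 * (p * q)) LCL (input_state M) t s \<and> t \<le> 600 * (p * q) \<and>
    LCL_returns M R \<and> outputs p q s R"
proof -
  define N where "N = p * q"
  define W where "W = 10 * N"
  define s0 where "s0 = input_state M"
  have dims: "dim_row M = p" "dim_col M = q" using M by auto
  have pq: "p \<le> N" "q \<le> N" "1 \<le> N" using p q by (simp_all add: N_def)
  have cell: "i * q + q \<le> N" if "i < p" for i
    using mult_le_mono1[of "Suc i" p q] that by (simp add: N_def)
  have s0: "reg s0 rP = p" "reg s0 rQ = q" "\<And>x. N \<le> x \<Longrightarrow> mem s0 x = 0"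
    by (simp_all add: s0_def input_state_def dims N_def)
  have in0: "mem s0 (i * q + j) = M $$ (i, j)" if "i < p" "j < q" for i j
    using cell[OF that(1)] that by (simp add: s0_def input_state_def dims N_def)

  obtain t1 s1 where e1: "exec W init s0 t1 s1" and t1: "t1 \<le> 8 * N" and m1: "mem s1 = mem s0"
    and r1: "reg s1 rOne = 1" "reg s1 rZero = 0" "reg s1 rSize = p * q" "reg s1 rP = p" "reg s1 rQ = q"
    by (rule init[OF s0(1,2) _ p q, of W]) (auto simp: W_def N_def)
  obtain t2 s2 where e2: "exec W copy_input s1 t2 s2" and t2: "t2 \<le> 30 * N"
    and copy: "\<And>i j. i < p \<Longrightarrow> j < q \<Longrightarrow> mem s2 (N + i * q + j) = mem s1 (i * q + j)"
      "\<And>x. x < N \<or> 2 * N \<le> x \<Longrightarrow> mem s2 x = mem s1 x"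
    and r2: "reg s2 rOne = 1" "reg s2 rZero = 0" "reg s2 rSize = N" "reg s2 rP = p" "reg s2 rQ = q"
    unfolding N_def by (rule copy_input[OF r1 _ p q, of W]) (auto simp: W_def N_def)
  have lay2: "laid_out (mem s2) 0 q 1 M" "laid_out (mem s2) N 1 q (transpose_mat M)"
  proof -
    have "mem s2 (i * q + j) = M $$ (i, j)" if "i < p" "j < q" for i j
      using copy(2)[of "i * q + j"] cell[OF that(1)] that in0 m1 by simp
    then show "laid_out (mem s2) 0 q 1 M" by (simp add: laid_out_def dims)
    show "laid_out (mem s2) N 1 q (transpose_mat M)"
      using copy(1) in0 m1 by (simp add: laid_out_transpose) (simp add: laid_out_def dims)
  qed
  have zero2: "mem s2 x = 0" if "2 * N \<le> x" for x
    using copy(2)[of x] s0(3)[of x] m1 that by simp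

  have "runs W setup_LC s2 (\<lambda>t s'. t = 7 \<and> mem s' = mem s2 \<and> reg s' rBase = 0 \<and> reg s' rM = p \<and>
    reg s' rN = q \<and> reg s' rRS = q \<and> reg s' rCS = 1 \<and> reg s' rSet = 2 * N \<and> reg s' rSet2 = 3 * N \<and>
    agree {rBase, rM, rN, rRS, rCS, rSet, rSet2} s2 s')"
    using r2 unfolding setup_LC_def by (simp add: step_simps agree_def W_def)
  then obtain s3 where e3: "exec W setup_LC s2 7 s3" and m3: "mem s3 = mem s2"
    and r3: "reg s3 rBase = 0" "reg s3 rRS = q" "reg s3 rCS = 1" "reg s3 rM = p"
      "reg s3 rN = q" "reg s3 rSet = 2 * N" "reg s3 rSet2 = 3 * N"
    and ag3: "agree {rBase, rM, rN, rRS, rCS, rSet, rSet2} s2 s3"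
    unfolding runs_def by blast
  have r3': "reg s3 rOne = 1" "reg s3 rZero = 0" "reg s3 rSize = N" "reg s3 rP = p" "reg s3 rQ = q"
    using r2 by (simp_all add: agree_reg[OF ag3])

  \<comment> \<open>Uniqueness of quotient and remainder modulo \<open>q\<close>. The second part
    uses it with lines and columns exchanged.\<close>
  have inj: "r = r' \<and> c = c'" if "c < q" "c' < q" "r * q + c = r' * q + c'" for r c r' c'
  proof -
    have "r = (r * q + c) div q" using that(1) by simp
    also have "\<dots> = r'" unfolding that(3) using that(2) by simp
    finally show ?thesis using that(3) by simp
  qed

  obtain D1 L1 C1 where LC: "LC_part M = (D1, L1, C1)" by (metis prod_cases3)
  obtain t4 s4 where e4: "exec W part s3 t4 s4" and t4: "t4 \<le> 220 * (p * q)"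
    and D1: "0 < dim_row D1" "dim_row D1 \<le> p" "0 < dim_col D1" "dim_col D1 \<le> q" "binary_mat D1"
      "L1 \<subseteq> {..<p - 1}" "C1 \<subseteq> {..<q - 1}"
    and r4: "reg s4 rM = dim_row D1" "reg s4 rN = dim_col D1" "reg s4 rCount = density D1"
    and lay4: "laid_out (mem s4) (reg s4 rBase) q 1 D1"
    and base4: "reg s4 rBase + dim_row D1 * q + dim_col D1 * 1 = 0 + p * q + q * 1"
    and sets4: "\<And>x. x < p - 1 \<Longrightarrow> mem s4 (2 * N + x) = (if x \<in> L1 then 1 else 0)"
      "\<And>x. x < q - 1 \<Longrightarrow> mem s4 (3 * N + x) = (if x \<in> C1 then 1 else 0)"
    and old4: "\<And>x. \<not> (0 \<le> x \<and> x < N) \<Longrightarrow> \<not> (2 * N \<le> x \<and> x < 2 * N + (p - 1)) \<Longrightarrow>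
      \<not> (3 * N \<le> x \<and> x < 3 * N + (q - 1)) \<Longrightarrow> mem s4 x = mem s3 x"
    and ag4: "agree (writes part) s3 s4"
  proof -
    have bounds: "0 + p * q + q * 1 \<le> W" "2 * N + p \<le> W" "3 * N + q \<le> W" "4 * (p * q) \<le> W" "2 \<le> W"
      using pq unfolding W_def N_def[symmetric] by linarith+
    have inj': "r = r' \<and> c = c'"
      if "r < p" "c < q" "r' < p" "c' < q" "0 + r * q + c * 1 = 0 + r' * q + c' * 1" for r c r' c'
      using inj[of c c' r r'] that by simp
    have region: "0 \<le> 0 + r * q + c * 1 \<and> 0 + r * q + c * 1 < N" if "r < p" "c < q" for r c
      using cell[OF that(1)] that by simp
    have le: "N \<le> 2 * N" "2 * N + p \<le> 3 * N" using pq by linarith+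
    have lay: "laid_out (mem s3) 0 q 1 M" using lay2 m3 by simp
    have zero: "mem s3 (2 * N + x) = 0" if "x < p - 1" for x using zero2 m3 by simp
    have zero': "mem s3 (3 * N + x) = 0" if "x < q - 1" for x using zero2 m3 by simp
    have one: "0 < (1 :: nat)" by simp
    show thesis
      by (rule part[of s3 0 q 1 M "2 * N" "3 * N" W 0 N, unfolded dims, OF r3'(1,2) r3 bounds p q q one inj' region le
            lay M(2) zero zero' LC]) (assumption | rule that)+
  qed
  have r4': "reg s4 rOne = 1" "reg s4 rZero = 0" "reg s4 rSize = N" "reg s4 rP = p" "reg s4 rQ = q"
    "reg s4 rSet2 = 3 * N"
    using r3 r3' by (simp_all add: part_keeps[OF ag4])

  have "runs W setup_CL s4 (\<lambda>t s'. t = 13 \<and> mem s' = mem s4 \<and> reg s' rBase = N \<and> reg s' rM = q \<and>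
    reg s' rN = p \<and> reg s' rRS = 1 \<and> reg s' rCS = q \<and> reg s' rSet = 4 * N \<and> reg s' rSet2 = 5 * N \<and>
    reg s' rBase1 = reg s4 rBase \<and> reg s' rM1 = dim_row D1 \<and> reg s' rN1 = dim_col D1 \<and>
    reg s' rDensity1 = density D1 \<and> reg s' rLines = 2 * N \<and> reg s' rCols = 3 * N \<and>
    agree {rBase, rM, rN, rRS, rCS, rSet, rSet2, rBase1, rM1, rN1, rDensity1, rLines, rCols} s4 s')"
    using r4 r4' r4'(5)[unfolded One_nat_def]
    unfolding setup_CL_def by (simp add: step_simps agree_def W_def)
  then obtain s5 where e5: "exec W setup_CL s4 13 s5" and m5: "mem s5 = mem s4"
    and r5: "reg s5 rBase = N" "reg s5 rRS = 1" "reg s5 rCS = q" "reg s5 rM = q"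
      "reg s5 rN = p" "reg s5 rSet = 4 * N" "reg s5 rSet2 = 5 * N"
    and kept5: "reg s5 rBase1 = reg s4 rBase" "reg s5 rM1 = dim_row D1" "reg s5 rN1 = dim_col D1"
      "reg s5 rDensity1 = density D1" "reg s5 rLines = 2 * N" "reg s5 rCols = 3 * N"
    and ag5: "agree {rBase, rM, rN, rRS, rCS, rSet, rSet2, rBase1, rM1, rN1, rDensity1, rLines, rCols} s4 s5"
    unfolding runs_def by blast
  have r5': "reg s5 rOne = 1" "reg s5 rZero = 0" "reg s5 rSize = N" "reg s5 rQ = q"
    using r4' by (simp_all add: agree_reg[OF ag5])

  \<comment> \<open>The first part writes only below \<open>N\<close> and to its two sets between
    \<open>2 * N\<close> and \<open>4 * N\<close>, so the copy of the input and the cells for the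
    later sets are intact.\<close>
  have m5_old: "mem s5 x = mem s2 x" if "N \<le> x \<and> x < 2 * N \<or> 4 * N \<le> x" for x
    using old4[of x] that pq m3 m5 by auto
  have lay5: "laid_out (mem s5) N 1 q (transpose_mat M)"
  proof -
    have "mem s5 (N + i * q + j) = mem s2 (N + i * q + j)" if "i < p" "j < q" for i j
      using cell[OF that(1)] that by (intro m5_old) auto
    then show ?thesis
      using lay2(2) by (simp add: laid_out_transpose) (simp add: laid_out_def dims)
  qed
  have zero5: "mem s5 x = 0" if "4 * N \<le> x" for x
    using m5_old[of x] zero2[of x] that by simp

  obtain E C2 L2 where CL': "LC_part (transpose_mat M) = (E, C2, L2)" by (metis prod_cases3)
  have CL: "CL_part M = (transpose_mat E, L2, C2)" by (simp add: CL_part_transpose CL')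
  have dimsT: "dim_row (transpose_mat M) = q" "dim_col (transpose_mat M) = p" by (simp_all add: dims)
  obtain t6 s6 where e6: "exec W part s5 t6 s6" and t6: "t6 \<le> 220 * (q * p)"
    and E: "0 < dim_row E" "dim_row E \<le> q" "0 < dim_col E" "dim_col E \<le> p" "binary_mat E"
      "C2 \<subseteq> {..<q - 1}" "L2 \<subseteq> {..<p - 1}"
    and r6: "reg s6 rM = dim_row E" "reg s6 rN = dim_col E" "reg s6 rCount = density E"
    and lay6: "laid_out (mem s6) (reg s6 rBase) 1 q E"
    and base6: "reg s6 rBase + dim_row E * 1 + dim_col E * q = N + q * 1 + p * q"
    and sets6: "\<And>x. x < q - 1 \<Longrightarrow> mem s6 (4 * N + x) = (if x \<in> C2 then 1 else 0)"
      "\<And>x. x < p - 1 \<Longrightarrow> mem s6 (5 * N + x) = (if x \<in> L2 then 1 else 0)"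
    and old6: "\<And>x. \<not> (N \<le> x \<and> x < 2 * N) \<Longrightarrow> \<not> (4 * N \<le> x \<and> x < 4 * N + (q - 1)) \<Longrightarrow>
      \<not> (5 * N \<le> x \<and> x < 5 * N + (p - 1)) \<Longrightarrow> mem s6 x = mem s5 x"
    and ag6: "agree (writes part) s5 s6"
  proof -
    have bounds: "N + q * 1 + p * q \<le> W" "4 * N + q \<le> W" "5 * N + p \<le> W" "4 * (q * p) \<le> W" "2 \<le> W"
      using pq unfolding W_def mult.commute[of q p] N_def[symmetric] by linarith+
    have inj': "r = r' \<and> c = c'"
      if "r < q" "c < p" "r' < q" "c' < p" "N + r * 1 + c * q = N + r' * 1 + c' * q" for r c r' c'
      using inj[of r r' c c'] that by simp
    have region: "N \<le> N + r * 1 + c * q \<and> N + r * 1 + c * q < 2 * N" if "r < q" "c < p" for r c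
      using cell[OF that(2)] that by simp
    have le: "2 * N \<le> 4 * N" "4 * N + q \<le> 5 * N" using pq by linarith+
    have bin: "binary_mat (transpose_mat M)" using M by (simp add: binary_mat_transpose)
    have zero: "mem s5 (4 * N + x) = 0" if "x < q - 1" for x using zero5 by simp
    have zero': "mem s5 (5 * N + x) = 0" if "x < p - 1" for x using zero5 by simp
    have one: "0 < (1 :: nat)" by simp
    show thesis
      by (rule part[of s5 N 1 q "transpose_mat M" "4 * N" "5 * N" W N "2 * N", unfolded dimsT, OF r5'(1,2) r5 bounds q p one q
            inj' region le lay5 bin zero zero' CL']) (assumption | rule that)+
  qed
  have r6': "reg s6 rOne = 1" "reg s6 rSize = N" "reg s6 rQ = q" "reg s6 rSet2 = 5 * N"
      "reg s6 rBase1 = reg s4 rBase" "reg s6 rM1 = dim_row D1" "reg s6 rN1 = dim_col D1"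
      "reg s6 rDensity1 = density D1" "reg s6 rLines = 2 * N" "reg s6 rCols = 3 * N"
    using r5 r5' kept5 by (simp_all add: part_keeps[OF ag6])
  have m6_old: "mem s6 x = mem s4 x" if "x < N \<or> 2 * N \<le> x \<and> x < 4 * N" for x
    using old6[of x] that pq m5 by auto
  have lay6': "laid_out (mem s6) (reg s4 rBase) q 1 D1"
  proof -
    have "mem s6 (reg s4 rBase + i * q + j) = mem s4 (reg s4 rBase + i * q + j)"
      if "i < dim_row D1" "j < dim_col D1" for i j
    proof (rule m6_old)
      \<comment> \<open>By \<open>base4\<close> the last cell of \<open>D1\<close> has address
        \<open>N - 1\<close>, so the first alternative holds.\<close>
      have "Suc i * q \<le> dim_row D1 * q" using that by (intro mult_le_mono1) simp
      then show "reg s4 rBase + i * q + j < N \<or>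
          2 * N \<le> reg s4 rBase + i * q + j \<and> reg s4 rBase + i * q + j < 4 * N"
        using base4 that unfolding mult_Suc N_def by linarith
    qed
    then show ?thesis using lay4 by (simp add: laid_out_def)
  qed

  \<comment> \<open>Both branches are brought to the same description, so that \<open>finish\<close>
    is analysed only once. A tie goes to the first part.\<close>
  have "\<exists>s7 D L C t7. exec W select_part s6 t7 s7 \<and> t7 \<le> 7 \<and> LCL_returns M (D, L, C) \<and>
      reg s7 rOne = 1 \<and> reg s7 rSize = N \<and> reg s7 rSet2 = 5 * N \<and> reg s7 rQ = q \<and>
      reg s7 rM = dim_row D \<and> reg s7 rN = dim_col D \<and> dim_row D \<le> p \<and> dim_col D \<le> q \<and>
      reg s7 rA + dim_row D * q + dim_col D \<le> 2 * N + q \<and> laid_out (mem s7) (reg s7 rA) q 1 D \<and>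
      L \<subseteq> {..<p - 1} \<and> (\<forall>x<p - 1. mem s7 (reg s7 rLines + x) = (if x \<in> L then 1 else 0)) \<and>
      reg s7 rLines \<le> 5 * N \<and>
      C \<subseteq> {..<q - 1} \<and> (\<forall>x<q - 1. mem s7 (reg s7 rCols + x) = (if x \<in> C then 1 else 0)) \<and>
      reg s7 rCols \<le> 5 * N"
  proof (cases "density D1 < density E")
    case True
    have "runs W select_part s6 (\<lambda>t s'. t = 7 \<and> mem s' = mem s6 \<and> reg s' rA = reg s6 rBase \<and>
      reg s' rM = dim_col E \<and> reg s' rN = dim_row E \<and> reg s' rLines = 5 * N \<and> reg s' rCols = 4 * N \<and>
      agree {rCols, rLines, rA, rU, rM, rN} s6 s')"
      using True r6 r6' unfolding select_part_def by (simp add: step_simps agree_def)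
    then obtain s7 where e7: "exec W select_part s6 7 s7" and m7: "mem s7 = mem s6"
      and r7: "reg s7 rA = reg s6 rBase" "reg s7 rM = dim_col E" "reg s7 rN = dim_row E"
        "reg s7 rLines = 5 * N" "reg s7 rCols = 4 * N"
      and ag7: "agree {rCols, rLines, rA, rU, rM, rN} s6 s7"
      unfolding runs_def by blast
    \<comment> \<open>The program compared the density of \<open>E\<close>; that of the returned
      matrix is the same by \<open>density_transpose\<close>.\<close>
    have "LCL_returns M (transpose_mat E, L2, C2)"
      using True E by (simp add: LCL_returns_def CL LC density_transpose)
    moreover have "laid_out (mem s7) (reg s7 rA) q 1 (transpose_mat E)"
      using lay6 m7 r7 by (simp add: laid_out_transpose)
    moreover have "reg s7 rA + dim_col E * q + dim_row E \<le> 2 * N + q"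
      using base6 r7(1) by (simp add: N_def)
    moreover have "\<forall>x<p - 1. mem s7 (reg s7 rLines + x) = (if x \<in> L2 then 1 else 0)"
      "\<forall>x<q - 1. mem s7 (reg s7 rCols + x) = (if x \<in> C2 then 1 else 0)"
      using sets6 m7 r7 by simp_all
    moreover have "reg s7 rOne = 1" "reg s7 rSize = N" "reg s7 rSet2 = 5 * N" "reg s7 rQ = q"
      using r6' by (simp_all add: agree_reg[OF ag7])
    ultimately show ?thesis
      using e7 r7 E(2,4,6,7)
      by (intro exI[of _ s7] exI[of _ "transpose_mat E"] exI[of _ L2] exI[of _ C2] exI[of _ 7])
        (simp del: One_nat_def)
  next
    case False
    have "runs W select_part s6 (\<lambda>t s'. t = 4 \<and> mem s' = mem s6 \<and> reg s' rA = reg s4 rBase \<and>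
      reg s' rM = dim_row D1 \<and> reg s' rN = dim_col D1 \<and> agree {rA, rM, rN} s6 s')"
      using False r6 r6' unfolding select_part_def by (simp add: step_simps agree_def)
    then obtain s7 where e7: "exec W select_part s6 4 s7" and m7: "mem s7 = mem s6"
      and r7: "reg s7 rA = reg s4 rBase" "reg s7 rM = dim_row D1" "reg s7 rN = dim_col D1"
      and ag7: "agree {rA, rM, rN} s6 s7"
      unfolding runs_def by blast
    have r7': "reg s7 rOne = 1" "reg s7 rSize = N" "reg s7 rSet2 = 5 * N" "reg s7 rQ = q"
        "reg s7 rLines = 2 * N" "reg s7 rCols = 3 * N"
      using r6' by (simp_all add: agree_reg[OF ag7])
    have "LCL_returns M (D1, L1, C1)"
      using False E by (simp add: LCL_returns_def CL LC density_transpose)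
    moreover have "laid_out (mem s7) (reg s7 rA) q 1 D1"
      using lay6' m7 r7 by simp
    moreover have "reg s7 rA + dim_row D1 * q + dim_col D1 \<le> 2 * N + q"
      using base4 r7(1) by (simp add: N_def)
    moreover have "\<forall>x<p - 1. mem s7 (reg s7 rLines + x) = (if x \<in> L1 then 1 else 0)"
      "\<forall>x<q - 1. mem s7 (reg s7 rCols + x) = (if x \<in> C1 then 1 else 0)"
      using sets4 m6_old pq m7 r7' by simp_all
    ultimately show ?thesis
      using e7 r7 r7' D1(2,4,6,7)
      by (intro exI[of _ s7] exI[of _ D1] exI[of _ L1] exI[of _ C1] exI[of _ 4])
        (simp del: One_nat_def)
  qed
  then obtain s7 D L C t7 where e7: "exec W select_part s6 t7 s7" and t7: "t7 \<le> 7"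
    and R: "LCL_returns M (D, L, C)"
    and r7: "reg s7 rOne = 1" "reg s7 rSize = N" "reg s7 rSet2 = 5 * N" "reg s7 rQ = q"
      "reg s7 rM = dim_row D" "reg s7 rN = dim_col D"
    and D: "dim_row D \<le> p" "dim_col D \<le> q" "reg s7 rA + dim_row D * q + dim_col D \<le> 2 * N + q"
      "laid_out (mem s7) (reg s7 rA) q 1 D"
    and L: "L \<subseteq> {..<p - 1}" "\<forall>x<p - 1. mem s7 (reg s7 rLines + x) = (if x \<in> L then 1 else 0)"
      "reg s7 rLines \<le> 5 * N"
    and C: "C \<subseteq> {..<q - 1}" "\<forall>x<q - 1. mem s7 (reg s7 rCols + x) = (if x \<in> C then 1 else 0)"
      "reg s7 rCols \<le> 5 * N"
    by (elim exE conjE) (rule that)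
  obtain t8 s8 where e8: "exec W finish s7 t8 s8" and t8: "t8 \<le> 30 * N" and out: "outputs p q s8 (D, L, C)"
    by (rule finish[of s7 p q "reg s7 rA" D W L C, folded N_def])
       (use p q r7 D L C in \<open>simp_all add: W_def\<close>)
  have "exec W LCL s0 (t1 + (t2 + (7 + (t4 + (13 + (t6 + (t7 + t8))))))) s8"
    unfolding LCL_def
    by (rule exec.Seq[OF e1 exec.Seq[OF e2 exec.Seq[OF e3 exec.Seq[OF e4 exec.Seq[OF e5
          exec.Seq[OF e6 exec.Seq[OF e7 e8]]]]]]])
  moreover have "t4 \<le> 220 * N" "t6 \<le> 220 * N" using t4 t6 by (simp_all add: N_def mult.commute)
  \<comment> \<open>With \<open>1 <= N\<close> the total is at most 8 + 30 + 7 + 220 + 13 + 220 + 7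
    + 30 = 535 per cell.\<close>
  then have "t1 + (t2 + (7 + (t4 + (13 + (t6 + (t7 + t8)))))) \<le> 600 * N"
    using t1 t2 t7 t8 pq(3) by linarith
  ultimately show ?thesis
    using R out unfolding W_def N_def s0_def by blast
qed

theorem theorem3:
  shows "\<exists>(c::com) (K::nat) (D::nat). \<forall>(p::nat) (q::nat) (M::nat mat).
    p \<ge> 1 \<longrightarrow> q \<ge> 1 \<longrightarrow> M \<in> carrier_mat p q \<longrightarrow> binary_mat M \<longrightarrow>
    (\<exists>t s R. exec (D * (p * q)) c (input_state M) t s \<and> t \<le> K * (p * q) \<and>
             LCL_returns M R \<and> outputs p q s R)"
proof (rule exI[of _ LCL], rule exI[of _ 600], rule exI[of _ 10], intro allI impI)
  fix p q :: nat and M :: "nat mat"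
  assume "p \<ge> 1" "q \<ge> 1" "M \<in> carrier_mat p q" "binary_mat M"
  then show "\<exists>t s R. exec (10 * (p * q)) LCL (input_state M) t s \<and> t \<le> 600 * (p * q) \<and>
      LCL_returns M R \<and> outputs p q s R"
    by (intro LCL_correct) simp_all
qed

end
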